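(* Let $\Omega\subset X$ be a $\nu$-measurable set with $0<\nu(\Omega)<\nu(X)$. If there exists a thresholding parameter $\lambda^*>0$ such that (1) $0\in M(\chi_\Omega,\lambda)$ for all $0<\lambda<\lambda^*$, and (2) $\chi_\Omega\in M(\chi_\Omega,\lambda)$ for all $\lambda>\lambda^*$, then $$\lambda(\Omega)=\lambda^*=\lambda_\Omega^m,$$ and $\left(\lambda_\Omega^m,\frac1{\nu(\Omega)}\chi_\Omega\right)$ is an $m$-eigenpair. In particular, $\Omega$ is $m$-calibrable.
   Context: Setting: $(X,d)$ is a Polish metric space with its Borel $\sigma$-algebra. A random walk $m=(m_x)_{x\in X}$ on $X$ is a family of Borel probability measures on $X$ such that $x\mapsto m_x(A)$ is Borel for every Borel $A\subset X$ and $\int_X d(z,y)\,dm_x(y)<\infty$ for all $x\in X$ and some (hence any) $z\in X$; $[X,d,m]$ is a metric random walk space. $\nu$ is a finite (nonzero) Radon measure on $X$ which is reversible for $m$: $dm_x(y)d\nu(x)=dm_y(x)d\nu(y)$ as measures on $X\times X$ (this implies invariance, $\nu(A)=\int_X m_x(A)\,d\nu(x)$). It is also assumed that $\frac1{\nu(X)}\nu$ is ergodic with respect to $m$: every Borel set $B$ with $m_x(B)=1$ for all $x\in B$ satisfies $\nu(B)=0$ or $\nu(B)=\nu(X)$. $m$-total variation: $TV_m(u)=\frac12\int_X\int_X|u(y)-u(x)|\,dm_x(y)\,d\nu(x)$. $m$-perimeter: $P_m(E)=\int_E\int_{X\setminus E}dm_x(y)\,d\nu(x)$. $\lambda_E^m=\frac{P_m(E)}{\nu(E)}$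 for $\nu(E)>0$. $\Omega$ is $m$-calibrable if $\lambda_\Omega^m=\inf\{\lambda_E^m:E\subset\Omega,\ E\ \nu\text{-measurable},\ \nu(E)>0\}$. $\mathcal E_m(u,f,\lambda)=TV_m(u)+\lambda\int_X|u-f|\,d\nu$, and $M(f,\lambda)$ is the set of $u\in L^1(X,\nu)$ minimizing $\mathcal E_m(\cdot,f,\lambda)$ over $L^1(X,\nu)$. "$0\in M$" refers to the zero function. $\lambda(\Omega)=\inf\{\lambda>0:\chi_\Omega\in M(\chi_\Omega,\lambda)\}$ (the infimum is attained). $\mathcal F_m(u)=TV_m(u)$ on $L^2(X,\nu)$ (value $+\infty$ where $TV_m(u)=\infty$), with subdifferential $\partial\mathcal F_m$ in $L^2(X,\nu)$; $v\in\Delta_1^m u$ iff $-v\in\partial\mathcal F_m(u)$. A pair $(\lambda,u)\in\mathbb R\times L^2(X,\nu)$ is an $m$-eigenpair of $\Delta_1^m$ if $\|u\|_{L^1(X,\nu)}=1$ and there is $\xi\in\mathrm{sign}(u)$ with $\lambda\xi\in-\Delta_1^m u$ (i.e. $\lambda\xi\in\partial\mathcal F_m(u)$). Here $\xi\in\mathrm{sign}(u)$ means $\xi$ is $\nu$-measurable and, $\nu$-a.e., $\xi=1$ where $u>0$, $\xi=-1$ where $u<0$, $\xi\in[-1,1]$ where $u=0$. *)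

theory Defs
  imports "HOL-Probability.Probability"
begin

text \<open>
  The Polish metric space is a type of class \<open>polish_space\<close> (complete, separable metric).
  Finite Borel measures on such a space are automatically Radon, so \<open>\<nu>\<close> is
  only required to be a finite Borel measure.

  ``\<open>\<nu>\<close>-measurable'' means measurable for the completion of \<open>\<nu>\<close>.  For a \<open>\<nu>\<close>-measurable
  set (or function) reversibility makes it measurable for the completion of
  \<open>m x\<close> for \<open>\<nu>\<close>-almost every \<open>x\<close>; this is why the integrals below are taken with respect to
  completions.  They agree with the usual integrals on Borel sets and functions.

  Elements of \<open>L\<^sup>1\<close> and \<open>L\<^sup>2\<close> are represented by functions; all notions below are
  invariant under changes on \<open>\<nu>\<close>-null sets.
\<close>

definition random_walk :: "('a::polish_space \<Rightarrow> 'a measure) \<Rightarrow> bool" where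
  "random_walk m \<longleftrightarrow>
     (\<forall>x. prob_space (m x) \<and> sets (m x) = sets borel) \<and>
     (\<forall>A \<in> sets borel. (\<lambda>x. emeasure (m x) A) \<in> borel_measurable borel) \<and>
     (\<exists>z. \<forall>x. (\<integral>\<^sup>+ y. ennreal (dist z y) \<partial>m x) < \<infinity>)"

definition reversible :: "('a::polish_space \<Rightarrow> 'a measure) \<Rightarrow> 'a measure \<Rightarrow> bool" where
  "reversible m \<nu> \<longleftrightarrow>
     (\<forall>C \<in> sets (borel \<Otimes>\<^sub>M borel).
        (\<integral>\<^sup>+ x. (\<integral>\<^sup>+ y. indicator C (x, y) \<partial>m x) \<partial>\<nu>) =
        (\<integral>\<^sup>+ y. (\<integral>\<^sup>+ x. indicator C (x, y) \<partial>m y) \<partial>\<nu>))"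

definition ergodic :: "('a::polish_space \<Rightarrow> 'a measure) \<Rightarrow> 'a measure \<Rightarrow> bool" where
  "ergodic m \<nu> \<longleftrightarrow>
     (\<forall>B \<in> sets borel. (\<forall>x \<in> B. emeasure (m x) B = 1) \<longrightarrow>
        emeasure \<nu> B = 0 \<or> emeasure \<nu> B = emeasure \<nu> UNIV)"

definition total_variation ::
  "('a::polish_space \<Rightarrow> 'a measure) \<Rightarrow> 'a measure \<Rightarrow> ('a \<Rightarrow> real) \<Rightarrow> ennreal" where
  "total_variation m \<nu> u =
     (\<integral>\<^sup>+ x. (\<integral>\<^sup>+ y. ennreal \<bar>u y - u x\<bar> \<partial>completion (m x)) \<partial>completion \<nu>) / 2"

definition perimeter ::
  "('a::polish_space \<Rightarrow> 'a measure) \<Rightarrow> 'a measure \<Rightarrow> 'a set \<Rightarrow> ennreal" where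
  "perimeter m \<nu> E =
     (\<integral>\<^sup>+ x \<in> E. (\<integral>\<^sup>+ y \<in> - E. 1 \<partial>completion (m x)) \<partial>completion \<nu>)"

text \<open>The perimeter is at most \<open>\<nu>(X) < \<infinity>\<close>, so passing to the reals loses nothing.\<close>

definition perimeter_ratio ::
  "('a::polish_space \<Rightarrow> 'a measure) \<Rightarrow> 'a measure \<Rightarrow> 'a set \<Rightarrow> real" where
  "perimeter_ratio m \<nu> E = enn2real (perimeter m \<nu> E) / measure (completion \<nu>) E"

definition calibrable ::
  "('a::polish_space \<Rightarrow> 'a measure) \<Rightarrow> 'a measure \<Rightarrow> 'a set \<Rightarrow> bool" where
  "calibrable m \<nu> \<Omega> \<longleftrightarrow>
     perimeter_ratio m \<nu> \<Omega> =
       Inf {perimeter_ratio m \<nu> E | E.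
              E \<subseteq> \<Omega> \<and> E \<in> sets (completion \<nu>) \<and> measure (completion \<nu>) E > 0}"

definition L1 :: "'a measure \<Rightarrow> ('a \<Rightarrow> real) set" where
  "L1 \<nu> = {u. integrable (completion \<nu>) u}"

definition L2 :: "'a measure \<Rightarrow> ('a \<Rightarrow> real) set" where
  "L2 \<nu> = {u \<in> borel_measurable (completion \<nu>). integrable (completion \<nu>) (\<lambda>x. (u x)\<^sup>2)}"

text \<open>The parameter \<open>l\<close> is meant to be positive (\<open>ennreal\<close> truncates negative reals).\<close>

definition energy ::
  "('a::polish_space \<Rightarrow> 'a measure) \<Rightarrow> 'a measure \<Rightarrow> ('a \<Rightarrow> real) \<Rightarrow> ('a \<Rightarrow> real) \<Rightarrow> real \<Rightarrow> ennreal"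
  where
  "energy m \<nu> u f l =
     total_variation m \<nu> u + ennreal l * (\<integral>\<^sup>+ x. ennreal \<bar>u x - f x\<bar> \<partial>completion \<nu>)"

definition minimizers ::
  "('a::polish_space \<Rightarrow> 'a measure) \<Rightarrow> 'a measure \<Rightarrow> ('a \<Rightarrow> real) \<Rightarrow> real \<Rightarrow> ('a \<Rightarrow> real) set"
  where
  "minimizers m \<nu> f l =
     {u \<in> L1 \<nu>. \<forall>v \<in> L1 \<nu>. energy m \<nu> u f l \<le> energy m \<nu> v f l}"

definition threshold ::
  "('a::polish_space \<Rightarrow> 'a measure) \<Rightarrow> 'a measure \<Rightarrow> 'a set \<Rightarrow> real" where
  "threshold m \<nu> \<Omega> = Inf {l. l > 0 \<and> indicator \<Omega> \<in> minimizers m \<nu> (indicator \<Omega>) l}"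

definition TV_functional ::
  "('a::polish_space \<Rightarrow> 'a measure) \<Rightarrow> 'a measure \<Rightarrow> ('a \<Rightarrow> real) \<Rightarrow> ereal" where
  "TV_functional m \<nu> u = enn2ereal (total_variation m \<nu> u)"

definition subdifferential ::
  "'a measure \<Rightarrow> (('a \<Rightarrow> real) \<Rightarrow> ereal) \<Rightarrow> ('a \<Rightarrow> real) \<Rightarrow> ('a \<Rightarrow> real) set" where
  "subdifferential \<nu> F u =
     {v \<in> L2 \<nu>. u \<in> L2 \<nu> \<and> \<bar>F u\<bar> \<noteq> \<infinity> \<and>
        (\<forall>w \<in> L2 \<nu>. F u + ereal (\<integral>x. v x * (w x - u x) \<partial>completion \<nu>) \<le> F w)}"

definition one_laplacian ::
  "('a::polish_space \<Rightarrow> 'a measure) \<Rightarrow> 'a measure \<Rightarrow> ('a \<Rightarrow> real) \<Rightarrow> ('a \<Rightarrow> real) set" where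
  "one_laplacian m \<nu> u = {v. (\<lambda>x. - v x) \<in> subdifferential \<nu> (TV_functional m \<nu>) u}"

definition sign_selections :: "'a measure \<Rightarrow> ('a \<Rightarrow> real) \<Rightarrow> ('a \<Rightarrow> real) set" where
  "sign_selections \<nu> u =
     {\<xi> \<in> borel_measurable (completion \<nu>).
        AE x in completion \<nu>. (u x > 0 \<longrightarrow> \<xi> x = 1) \<and> (u x < 0 \<longrightarrow> \<xi> x = - 1) \<and>
                              (u x = 0 \<longrightarrow> \<xi> x \<in> {-1..1})}"

definition eigenpair ::
  "('a::polish_space \<Rightarrow> 'a measure) \<Rightarrow> 'a measure \<Rightarrow> real \<Rightarrow> ('a \<Rightarrow> real) \<Rightarrow> bool" where
  "eigenpair m \<nu> l u \<longleftrightarrow>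
     u \<in> L2 \<nu> \<and> (\<integral>x. \<bar>u x\<bar> \<partial>completion \<nu>) = 1 \<and>
     (\<exists>\<xi> \<in> sign_selections \<nu> u. (\<lambda>x. - (l * \<xi> x)) \<in> one_laplacian m \<nu> u)"

end

theory Submission
  imports Defs
begin

text \<open>
  Write \<open>\<chi>\<close> for the indicator function of \<open>\<Omega>\<close>.  The two hypotheses survive the limits \<open>l \<up> lstar\<close>
  and \<open>l \<down> lstar\<close>, so at \<open>l = lstar\<close> both \<open>0\<close> and \<open>\<chi>\<close> minimize the energy.  Equality of their
  energies reads \<open>lstar * \<nu>(\<Omega>) = TV(\<chi>) = P(\<Omega>)\<close>, which identifies \<open>lstar\<close>; and \<open>\<chi>\<close> cannot minimize
  for smaller \<open>l\<close>, since \<open>0\<close> would then have less energy.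

  The remaining claims rest on the minimality of \<open>0\<close>.  Its optimality condition in a
  bounded direction \<open>w\<close> is
  \<open>lstar * (\<integral>\<^sub>\<Omega> w d\<nu> - \<integral>\<^bsub>X-\<Omega>\<^esub> \<bar>w\<bar> d\<nu>) \<le> TV(w)\<close> (\<open>zero_minimizer_imp_slope_le\<close>).
  With \<open>w = \<chi>\<^sub>F\<close> for \<open>F \<subseteq> \<Omega>\<close> this is \<open>lstar * \<nu>(F) \<le> P(F)\<close>, that is, calibrability.

  For the eigenpair one needs \<open>\<xi>\<close> with \<open>\<xi> = 1\<close> on \<open>\<Omega>\<close> and \<open>\<bar>\<xi>\<bar> \<le> 1\<close> elsewhere such that
  \<open>lstar * \<integral> \<xi> w d\<nu> \<le> TV(w)\<close> for all \<open>w\<close>; equality for \<open>w = \<chi> / \<nu>(\<Omega>)\<close> is then automatic, and by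
  homogeneity of the total variation this makes \<open>lstar * \<xi>\<close> a subgradient there.  The left side
  of the optimality condition is the minimum of \<open>lstar * \<integral> \<xi> w d\<nu>\<close> over all admissible \<open>\<xi>\<close>, and the
  right side is the maximum of \<open>\<integral> d w d\<nu>\<close> over the subgradients \<open>d\<close> of the total variation at
  \<open>0\<close>.  It is attained at \<open>d(x) = \<integral> sgn (w x - w y) dm\<^sub>x(y)\<close>, by reversibility.
  So no \<open>w\<close> separates the two convex sets, and a minimax argument (\<open>exists_calibration\<close>) gives a
  common element.  Its analytic core is \<open>AE_closed_convex_meet\<close>, a separation theorem for convex sets of
  uniformly bounded functions that is proved by projecting in \<open>L\<^sup>2\<close>.

  All this takes place among bounded Borel functions: reversibility allows changes on null sets,
  and truncation reaches the remaining square-integrable functions.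
\<close>

section \<open>Separation of convex sets of bounded functions\<close>

context finite_measure
begin

lemma integrable_bounded:
  fixes f :: "'a \<Rightarrow> real"
  assumes "f \<in> borel_measurable M" "\<And>x. \<bar>f x\<bar> \<le> B"
  shows "integrable M f"
  using assms by (intro integrable_const_bound[where B = B]) auto

lemma integral_bounded_convergence:
  fixes f :: "nat \<Rightarrow> 'a \<Rightarrow> real"
  assumes "\<And>n. f n \<in> borel_measurable M" "\<And>n x. \<bar>f n x\<bar> \<le> B" "c \<in> borel_measurable M"
    and "AE x in M. (\<lambda>n. f n x) \<longlonglongrightarrow> c x"
  shows "(\<lambda>n. \<integral>x. f n x \<partial>M) \<longlonglongrightarrow> (\<integral>x. c x \<partial>M)"
  using assms by (intro integral_dominated_convergence[where w = "\<lambda>_. B"]) auto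

text \<open>
  On a finite measure space, geometric decay of the \<open>L\<^sup>2\<close> norms of the increments makes their
  \<open>L\<^sup>1\<close> norms summable, so almost everywhere the increments form an absolutely convergent series.
\<close>

lemma AE_convergent_if_L2_rate:
  fixes f :: "nat \<Rightarrow> 'a \<Rightarrow> real"
  assumes meas[measurable]: "\<And>n. f n \<in> borel_measurable M"
    and bnd: "\<And>n x. \<bar>f n x\<bar> \<le> B"
    and rate: "\<And>n. (\<integral>x. (f n x - f (Suc n) x)\<^sup>2 \<partial>M) \<le> K * (1/4) ^ n"
  obtains c where "c \<in> borel_measurable M" "\<And>x. \<bar>c x\<bar> \<le> B"
    "AE x in M. (\<lambda>n. f n x) \<longlonglongrightarrow> c x"
proof -
  have B: "0 \<le> B" using order_trans[OF abs_ge_zero bnd[of 0 undefined]] .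
  let ?a = "\<lambda>n x. \<bar>f n x - f (Suc n) x\<bar>"
  define V where "V = measure M (space M)"
  have a_le: "?a n x \<le> 2 * B" for n x
    using bnd[of n x] bnd[of "Suc n" x] by linarith
  have int_a: "integrable M (?a n)" for n
    using a_le by (intro integrable_bounded[where B = "2 * B"]) auto
  have int_a2: "integrable M (\<lambda>x. (f n x - f (Suc n) x)\<^sup>2)" for n
  proof (rule integrable_bounded[where B = "(2 * B)\<^sup>2"])
    show "\<bar>(f n x - f (Suc n) x)\<^sup>2\<bar> \<le> (2 * B)\<^sup>2" for x
      using a_le[of n x] B abs_le_square_iff[of "f n x - f (Suc n) x" "2 * B"] by simp
  qed simp
  have L1: "(\<integral>x. ?a n x \<partial>M) \<le> (K + V) * (1/2) ^ n" for n
  proof -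
    \<comment> \<open>Weighted arithmetic-geometric mean inequality with weight \<open>2 ^ n\<close>, in place of Cauchy-Schwarz.\<close>
    have "?a n x \<le> 2 ^ n * (f n x - f (Suc n) x)\<^sup>2 + (1/2) ^ n" for x
    proof -
      have "0 \<le> (2 ^ n * ?a n x - 1/2)\<^sup>2" by simp
      also have "\<dots> = 2 ^ n * (2 ^ n * (f n x - f (Suc n) x)\<^sup>2 - ?a n x) + 1/4"
        by (simp add: power2_eq_square algebra_simps)
      finally have "2 ^ n * ?a n x \<le> 2 ^ n * (2 ^ n * (f n x - f (Suc n) x)\<^sup>2) + 1"
        by (simp add: algebra_simps)
      then show ?thesis
        by (simp add: field_simps power_divide)
    qed
    then have "(\<integral>x. ?a n x \<partial>M) \<le> (\<integral>x. 2 ^ n * (f n x - f (Suc n) x)\<^sup>2 + (1/2) ^ n \<partial>M)"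
      using int_a int_a2 by (intro integral_mono) auto
    also have "\<dots> = 2 ^ n * (\<integral>x. (f n x - f (Suc n) x)\<^sup>2 \<partial>M) + (1/2) ^ n * V"
      using int_a2 by (subst Bochner_Integration.integral_add) (auto simp: V_def)
    also have "\<dots> \<le> 2 ^ n * (K * (1/4) ^ n) + (1/2) ^ n * V"
      using rate[of n] by (intro add_mono mult_left_mono) auto
    also have "\<dots> = (K + V) * (1/2) ^ n"
    proof -
      have "(2::real) ^ n * (1/4) ^ n = (1/2) ^ n"
        by (simp add: power_mult_distrib[symmetric])
      then show ?thesis by (simp add: algebra_simps)
    qed
    finally show ?thesis .
  qed
  have KV: "0 \<le> K + V"
    using order_trans[OF integral_nonneg_AE L1[of 0]] by simp
  have "(\<integral>\<^sup>+x. (\<Sum>n. ennreal (?a n x)) \<partial>M) = (\<Sum>n. \<integral>\<^sup>+x. ennreal (?a n x) \<partial>M)"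
    by (intro nn_integral_suminf) auto
  also have "\<dots> = (\<Sum>n. ennreal (\<integral>x. ?a n x \<partial>M))"
    using int_a by (simp add: nn_integral_eq_integral)
  also have "\<dots> \<le> (\<Sum>n. ennreal ((K + V) * (1/2) ^ n))"
    using L1 by (intro suminf_le) (auto intro: ennreal_leI)
  also have "\<dots> = ennreal (\<Sum>n. (K + V) * (1/2) ^ n)"
    using KV by (intro suminf_ennreal2) (auto intro!: summable_mult summable_geometric)
  also have "\<dots> < \<infinity>" by simp
  finally have "AE x in M. (\<Sum>n. ennreal (?a n x)) \<noteq> \<infinity>"
    by (intro nn_integral_PInf_AE) auto
  then have conv: "AE x in M. convergent (\<lambda>n. f n x)"
  proof (rule AE_mp, intro AE_I2 impI)
    fix x assume "(\<Sum>n. ennreal (?a n x)) \<noteq> \<infinity>"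
    then have "summable (\<lambda>n. ?a n x)"
      by (intro summable_suminf_not_top) auto
    then have "summable (\<lambda>n. \<bar>f (Suc n) x - f n x\<bar>)"
      by (simp add: abs_minus_commute)
    then have "summable (\<lambda>n. f (Suc n) x - f n x)"
      by (rule summable_rabs_cancel)
    then have "convergent (\<lambda>n. f n x - f 0 x)"
      by (simp add: summable_iff_convergent sum_lessThan_telescope[of "\<lambda>n. f n x"])
    then show "convergent (\<lambda>n. f n x)"
      by (simp add: convergent_diff_const_right_iff)
  qed
  define c where "c x = max (- B) (min B (lim (\<lambda>n. f n x)))" for x
  show thesis
  proof
    show "c \<in> borel_measurable M"
      unfolding c_def using borel_measurable_lim_metric[OF meas] by measurable
    show "\<bar>c x\<bar> \<le> B" for x
      using B by (auto simp: c_def)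
    show "AE x in M. (\<lambda>n. f n x) \<longlonglongrightarrow> c x"
      using conv
    proof eventually_elim
      case (elim x)
      then have *: "(\<lambda>n. f n x) \<longlonglongrightarrow> lim (\<lambda>n. f n x)"
        by (simp add: convergent_LIMSEQ_iff)
      have "\<bar>lim (\<lambda>n. f n x)\<bar> \<le> B"
        using tendsto_rabs[OF *] bnd by (intro LIMSEQ_le_const2) auto
      then have "c x = lim (\<lambda>n. f n x)" by (auto simp: c_def)
      with * show ?case by simp
    qed
  qed
qed

text \<open>
  The Hilbert space projection argument for a decreasing sequence of convex sets: by the
  parallelogram identity, elements of the \<open>n\<close>-th set whose norms are close to the infimum there
  are close to each other, because these infima increase to a finite limit.  As all functions
  share a bound, the limit can be taken almost everywhere.  For a constant sequence of sets the limit is the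
  element of least norm of the closure; in general the existence of a limit replaces
  weak compactness.
\<close>

lemma nested_convex_min_norm:
  fixes F :: "nat \<Rightarrow> ('a \<Rightarrow> real) set"
  assumes ne: "\<And>n. F n \<noteq> {}" and dec: "\<And>n. F (Suc n) \<subseteq> F n"
    and mid: "\<And>n f g. f \<in> F n \<Longrightarrow> g \<in> F n \<Longrightarrow> (\<lambda>x. (f x + g x) / 2) \<in> F n"
    and meas: "\<And>n f. f \<in> F n \<Longrightarrow> f \<in> borel_measurable M"
    and bnd: "\<And>n f x. f \<in> F n \<Longrightarrow> \<bar>f x\<bar> \<le> B"
  obtains c f where "c \<in> borel_measurable M" "\<And>x. \<bar>c x\<bar> \<le> B" "\<And>n. f n \<in> F n"
    "AE x in M. (\<lambda>n. f n x) \<longlonglongrightarrow> c x"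
    "\<And>g. (\<And>n. g \<in> F n) \<Longrightarrow> (\<integral>x. (c x)\<^sup>2 \<partial>M) \<le> (\<integral>x. (g x)\<^sup>2 \<partial>M)"
proof -
  define N where "N g = (\<integral>x. (g x)\<^sup>2 \<partial>M)" for g :: "'a \<Rightarrow> real"
  define r where "r n = Inf (N ` F n)" for n
  define V where "V = measure M (space M)"
  have dec': "m \<le> n \<Longrightarrow> F n \<subseteq> F m" for m n
    using lift_Suc_antimono_le[of F] dec by blast
  have sq_le: "(g x)\<^sup>2 \<le> B\<^sup>2" if "g \<in> F n" for g n x
    using bnd[OF that, of x] by (meson abs_ge_self abs_le_square_iff order_trans)
  have int2: "integrable M (\<lambda>x. (g x)\<^sup>2)" if "g \<in> F n" for g n
    using meas[OF that] sq_le[OF that] by (intro integrable_bounded[where B = "B\<^sup>2"]) auto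
  have N0: "0 \<le> N g" for g by (simp add: N_def)
  have N_le: "N g \<le> B\<^sup>2 * V" if "g \<in> F n" for g n
  proof -
    have "N g \<le> (\<integral>x. B\<^sup>2 \<partial>M)"
      unfolding N_def using int2[OF that] sq_le[OF that] by (intro integral_mono) auto
    then show ?thesis by (simp add: V_def mult.commute)
  qed
  have bdd: "bdd_below (N ` F n)" for n
    by (rule bdd_belowI[where m = 0]) (auto simp: N0)
  have r_le: "r n \<le> N g" if "g \<in> F n" for n g
    unfolding r_def using that bdd by (intro cInf_lower) auto
  have r_mono: "r m \<le> r n" if "m \<le> n" for m n
    unfolding r_def using dec'[OF that] ne bdd by (intro cInf_superset_mono) auto
  have r_bdd: "r n \<le> B\<^sup>2 * V" for n
    using ne[of n] r_le N_le by (meson all_not_in_conv order_trans)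
  have "convergent r"
    using r_mono r_bdd by (intro Bseq_mono_convergent BseqI'[where K = "\<bar>r 0\<bar> + \<bar>B\<^sup>2 * V\<bar>"])
      (smt (verit) real_norm_def zero_le)+
  then obtain R where R: "r \<longlonglongrightarrow> R" by (auto simp: convergent_def)
  have r_R: "r n \<le> R" for n
    using r_mono by (intro LIMSEQ_le_const[OF R]) auto
  \<comment> \<open>The rate \<open>(1/4) ^ k\<close> for squared norms is what the convergence lemma above asks for.\<close>
  have "\<exists>m\<ge>k. R - (1/4) ^ k < r m" for k
  proof -
    have "eventually (\<lambda>n. R - (1/4) ^ k < r n) sequentially"
      using R by (rule order_tendstoD) simp
    then show ?thesis
      unfolding eventually_sequentially by (metis le_cases)
  qed
  then obtain s where s: "\<And>k. k \<le> s k" "\<And>k. R - (1/4) ^ k < r (s k)" by metis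
  \<comment> \<open>Running maxima, so that the levels increase with \<open>k\<close>.\<close>
  define t where "t k = (MAX i\<in>{..k}. s i)" for k
  have t_s: "s k \<le> t k" for k unfolding t_def by (intro Max_ge) auto
  have t_mono: "t k \<le> t (Suc k)" for k unfolding t_def by (intro Max_mono) auto
  have t_r: "R - (1/4) ^ k < r (t k)" for k
    using s(2)[of k] r_mono[OF t_s, of k] by linarith
  have "\<exists>g\<in>F (t k). N g < R + (1/4) ^ k" for k
  proof -
    have "Inf (N ` F (t k)) < R + (1/4) ^ k"
      using r_R[of "t k"] unfolding r_def by (smt (verit) zero_less_power zero_less_divide_iff)
    then show ?thesis
      using ne bdd by (subst (asm) cInf_less_iff) auto
  qed
  then obtain f where f: "\<And>k. f k \<in> F (t k)" "\<And>k. N (f k) < R + (1/4) ^ k" by metis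
  have fF: "f n \<in> F n" for n
    using f(1)[of n] dec'[of n "t n"] s(1)[of n] t_s[of n] by force
  have rate: "(\<integral>x. (f n x - f (Suc n) x)\<^sup>2 \<partial>M) \<le> 8 * (1/4) ^ n" for n
  proof -
    have f': "f (Suc n) \<in> F (t n)" using f(1)[of "Suc n"] dec'[OF t_mono] by auto
    define h where "h x = (f n x + f (Suc n) x) / 2" for x
    have h: "h \<in> F (t n)" unfolding h_def using mid[OF f(1) f'] .
    \<comment> \<open>The parallelogram identity.\<close>
    have "(f n x - f (Suc n) x)\<^sup>2 = 2 * (f n x)\<^sup>2 + 2 * (f (Suc n) x)\<^sup>2 - 4 * (h x)\<^sup>2" for x
      by (simp add: h_def power2_eq_square field_simps)
    then have "(\<integral>x. (f n x - f (Suc n) x)\<^sup>2 \<partial>M) = 2 * N (f n) + 2 * N (f (Suc n)) - 4 * N h"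
      unfolding N_def using int2[OF f(1)] int2[OF f'] int2[OF h] by simp
    also have "\<dots> \<le> 2 * (R + (1/4) ^ n) + 2 * (R + (1/4) ^ n) - 4 * (R - (1/4) ^ n)"
    proof -
      define q :: real where "q = (1/4) ^ n"
      have "(1/4) ^ Suc n \<le> q" by (simp add: q_def)
      then have "N (f (Suc n)) < R + q"
        by (intro less_le_trans[OF f(2)[of "Suc n"]] add_left_mono)
      moreover have "N (f n) < R + q" "R - q < N h"
        unfolding q_def by (rule f(2), rule less_le_trans[OF t_r r_le[OF h]])
      ultimately show ?thesis
        unfolding q_def[symmetric] by (intro diff_mono add_mono mult_left_mono) auto
    qed
    finally show ?thesis by simp
  qed
  obtain c where c: "c \<in> borel_measurable M" "\<And>x. \<bar>c x\<bar> \<le> B"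
    "AE x in M. (\<lambda>n. f n x) \<longlonglongrightarrow> c x"
    using AE_convergent_if_L2_rate[of f B 8] meas[OF fF] bnd[OF fF] rate by metis
  have "(\<lambda>n. N (f n)) \<longlonglongrightarrow> N c"
    unfolding N_def
  proof (rule integral_bounded_convergence[where B = "B\<^sup>2"])
    show "AE x in M. (\<lambda>n. (f n x)\<^sup>2) \<longlonglongrightarrow> (c x)\<^sup>2"
      using c(3) by eventually_elim (intro tendsto_intros)
  qed (use meas[OF fF] sq_le[OF fF] c(1) in auto)
  moreover have "(\<lambda>k. R + (1/4) ^ k) \<longlonglongrightarrow> R + 0"
    by (intro tendsto_intros LIMSEQ_power_zero) auto
  ultimately have NcR: "N c \<le> R"
    using f(2) by (intro LIMSEQ_le[where Y = "\<lambda>k. R + (1/4) ^ k"]) (auto intro: less_imp_le)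
  show thesis
  proof
    fix g assume "\<And>n. g \<in> F n"
    then have "R \<le> N g"
      using r_le by (intro LIMSEQ_le_const2[OF R]) auto
    with NcR show "(\<integral>x. (c x)\<^sup>2 \<partial>M) \<le> (\<integral>x. (g x)\<^sup>2 \<partial>M)" by (simp add: N_def)
  qed (use c fF in auto)
qed


text \<open>
  Separation of two convex sets of uniformly bounded functions, both closed under convergence
  almost everywhere: if no bounded function \<open>w\<close> separates them, then they meet.  The element \<open>w\<close>
  of least norm in the closure of \<open>C - D\<close> satisfies \<open>\<integral> w (c - d) \<ge> \<integral> w\<^sup>2\<close> for all \<open>c \<in> C\<close> and
  \<open>d \<in> D\<close>, so non-separation forces \<open>w = 0\<close>: the sets are at distance zero.  To find
  a common element, the projection argument is applied again, now to the nested sets of those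
  \<open>c \<in> C\<close> that are within distance \<open>1 / n\<close> (in squared norm) of \<open>D\<close>.
\<close>

lemma AE_closed_convex_meet:
  fixes C D :: "('a \<Rightarrow> real) set"
  assumes ne: "C \<noteq> {}" "D \<noteq> {}"
    and convex: "\<And>c c' t. c \<in> C \<Longrightarrow> c' \<in> C \<Longrightarrow> 0 \<le> t \<Longrightarrow> t \<le> 1 \<Longrightarrow> (\<lambda>x. (1 - t) * c x + t * c' x) \<in> C"
      "\<And>d d' t. d \<in> D \<Longrightarrow> d' \<in> D \<Longrightarrow> 0 \<le> t \<Longrightarrow> t \<le> 1 \<Longrightarrow> (\<lambda>x. (1 - t) * d x + t * d' x) \<in> D"
    and meas: "\<And>f. f \<in> C \<union> D \<Longrightarrow> f \<in> borel_measurable M"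
    and bnd: "\<And>f x. f \<in> C \<union> D \<Longrightarrow> \<bar>f x\<bar> \<le> B"
    and closed: "\<And>f g. \<lbrakk>\<And>n. f n \<in> C; g \<in> borel_measurable M; \<And>x. \<bar>g x\<bar> \<le> B;
        AE x in M. (\<lambda>n. f n x) \<longlonglongrightarrow> g x\<rbrakk> \<Longrightarrow> g \<in> C"
      "\<And>f g. \<lbrakk>\<And>n. f n \<in> D; g \<in> borel_measurable M; \<And>x. \<bar>g x\<bar> \<le> B;
        AE x in M. (\<lambda>n. f n x) \<longlonglongrightarrow> g x\<rbrakk> \<Longrightarrow> g \<in> D"
    and meet: "\<And>w A. w \<in> borel_measurable M \<Longrightarrow> (\<And>x. \<bar>w x\<bar> \<le> A) \<Longrightarrow>
        \<exists>c\<in>C. \<exists>d\<in>D. (\<integral>x. w x * c x \<partial>M) \<le> (\<integral>x. w x * d x \<partial>M)"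
  obtains c where "c \<in> C" "c \<in> D"
proof -
  define S where "S = {\<lambda>x. c x - d x | c d. c \<in> C \<and> d \<in> D}"
  have SI: "(\<lambda>x. c x - d x) \<in> S" if "c \<in> C" "d \<in> D" for c d
    unfolding S_def using that by blast
  have S_meas: "f \<in> borel_measurable M" if "f \<in> S" for f
    using that meas by (auto simp: S_def)
  have S_bnd: "\<bar>f x\<bar> \<le> 2 * B" if "f \<in> S" for f x
  proof -
    obtain c d where "f = (\<lambda>x. c x - d x)" "c \<in> C" "d \<in> D"
      using \<open>f \<in> S\<close> by (auto simp: S_def)
    then show ?thesis using bnd[of c x] bnd[of d x] by auto
  qed
  have S_convex: "(\<lambda>x. (1 - t) * f x + t * g x) \<in> S"
    if fg: "f \<in> S" "g \<in> S" and t: "0 \<le> t" "t \<le> 1" for f g t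
  proof -
    obtain c d c' d' where eq: "f = (\<lambda>x. c x - d x)" "g = (\<lambda>x. c' x - d' x)"
      and mem: "c \<in> C" "d \<in> D" "c' \<in> C" "d' \<in> D"
      using fg by (auto simp: S_def)
    have "(\<lambda>x. (1 - t) * f x + t * g x) =
        (\<lambda>x. ((1 - t) * c x + t * c' x) - ((1 - t) * d x + t * d' x))"
      by (auto simp: eq algebra_simps)
    then show ?thesis
      using SI[OF convex(1)[OF mem(1,3) t] convex(2)[OF mem(2,4) t]] by (simp only:)
  qed
  have S_mid: "(\<lambda>x. (f x + g x) / 2) \<in> S" if "f \<in> S" "g \<in> S" for f g
    using S_convex[OF that, of "1/2"] by (simp add: field_simps)
  have S_ne: "S \<noteq> {}" using ne by (auto simp: S_def)
  obtain w f where w: "w \<in> borel_measurable M" "\<And>x. \<bar>w x\<bar> \<le> 2 * B" and f: "\<And>n. f n \<in> S"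
    and lim: "AE x in M. (\<lambda>n. f n x) \<longlonglongrightarrow> w x"
    and min: "\<And>g. g \<in> S \<Longrightarrow> (\<integral>x. (w x)\<^sup>2 \<partial>M) \<le> (\<integral>x. (g x)\<^sup>2 \<partial>M)"
  proof (rule nested_convex_min_norm[of "\<lambda>_. S" "2 * B"])
    fix w f
    assume "w \<in> borel_measurable M" "\<And>x. \<bar>w x\<bar> \<le> 2 * B" "\<And>n. f n \<in> S"
      "AE x in M. (\<lambda>n. f n x) \<longlonglongrightarrow> w x"
      "\<And>g. (\<And>n::nat. g \<in> S) \<Longrightarrow> (\<integral>x. (w x)\<^sup>2 \<partial>M) \<le> (\<integral>x. (g x)\<^sup>2 \<partial>M)"
    then show thesis by (rule that)
  qed (rule S_ne order_refl S_mid S_meas S_bnd; assumption)+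
  note [measurable] = w(1) S_meas[OF f]
  have sq_bnd: "\<bar>(h x)\<^sup>2\<bar> \<le> (2 * B)\<^sup>2" if "\<And>x. \<bar>h x\<bar> \<le> 2 * B" for h :: "'a \<Rightarrow> real" and x
    using that[of x] by (metis abs_ge_self abs_le_square_iff abs_power2 order_trans)
  have prod_bnd: "\<bar>h x * k x\<bar> \<le> (2 * B) * (2 * B)"
    if "\<And>x. \<bar>h x\<bar> \<le> 2 * B" "\<And>x. \<bar>k x\<bar> \<le> 2 * B" for h k :: "'a \<Rightarrow> real" and x
    unfolding abs_mult using that[of x] by (intro mult_mono) (auto intro: order_trans[OF abs_ge_zero])
  \<comment> \<open>The variational inequality of the projection of \<open>0\<close> onto the closure of \<open>C - D\<close>.\<close>
  have var: "(\<integral>x. (w x)\<^sup>2 \<partial>M) \<le> (\<integral>x. w x * v x \<partial>M)" if v: "v \<in> S" for v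
  proof -
    note [measurable] = S_meas[OF v]
    note vb = S_bnd[OF v]
    have iw: "integrable M (\<lambda>x. (w x)\<^sup>2)" and iv: "integrable M (\<lambda>x. (v x)\<^sup>2)"
      and iwv: "integrable M (\<lambda>x. w x * v x)"
      by (rule integrable_bounded[OF _ sq_bnd[OF w(2)]] integrable_bounded[OF _ sq_bnd[OF vb]]
          integrable_bounded[OF _ prod_bnd[OF w(2) vb]]; measurable)+
    define q where "q = (\<integral>x. (w x)\<^sup>2 \<partial>M) - 2 * (\<integral>x. w x * v x \<partial>M) + (\<integral>x. (v x)\<^sup>2 \<partial>M)"
    \<comment> \<open>The first-order condition is read off from the segments from \<open>w\<close> to \<open>v\<close>.  Since \<open>w\<close> need not
    belong to \<open>S\<close>, each segment is approximated by those that start at \<open>f n\<close>.\<close>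
    have key: "2 * ((\<integral>x. (w x)\<^sup>2 \<partial>M) - (\<integral>x. w x * v x \<partial>M)) \<le> t * q" if t: "0 < t" "t \<le> 1" for t
    proof -
      have "(\<integral>x. (w x)\<^sup>2 \<partial>M) \<le> (\<integral>x. ((1 - t) * w x + t * v x)\<^sup>2 \<partial>M)"
      proof (rule LIMSEQ_le_const)
        have *: "\<And>n. (\<lambda>x. (1 - t) * f n x + t * v x) \<in> S"
          using S_convex[OF f v] t by auto
        show "(\<lambda>n. \<integral>x. ((1 - t) * f n x + t * v x)\<^sup>2 \<partial>M) \<longlonglongrightarrow> (\<integral>x. ((1 - t) * w x + t * v x)\<^sup>2 \<partial>M)"
        proof (rule integral_bounded_convergence[where B = "(2 * B)\<^sup>2"])
          show "AE x in M. (\<lambda>n. ((1 - t) * f n x + t * v x)\<^sup>2) \<longlonglongrightarrow> ((1 - t) * w x + t * v x)\<^sup>2"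
            using lim by eventually_elim (intro tendsto_intros)
        qed (use sq_bnd[OF S_bnd[OF *]] in auto)
        show "\<exists>N. \<forall>n\<ge>N. (\<integral>x. (w x)\<^sup>2 \<partial>M) \<le> (\<integral>x. ((1 - t) * f n x + t * v x)\<^sup>2 \<partial>M)"
          using min[OF *] by blast
      qed
      also have "\<dots> = (\<integral>x. (1 - t)\<^sup>2 * (w x)\<^sup>2 + 2 * (1 - t) * t * (w x * v x) + t\<^sup>2 * (v x)\<^sup>2 \<partial>M)"
        by (intro Bochner_Integration.integral_cong) (auto simp: power2_eq_square algebra_simps)
      also have "\<dots> = (1 - t)\<^sup>2 * (\<integral>x. (w x)\<^sup>2 \<partial>M) + 2 * (1 - t) * t * (\<integral>x. w x * v x \<partial>M)
          + t\<^sup>2 * (\<integral>x. (v x)\<^sup>2 \<partial>M)"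
        using iw iv iwv by simp
      finally have "t * (2 * ((\<integral>x. (w x)\<^sup>2 \<partial>M) - (\<integral>x. w x * v x \<partial>M))) \<le> t * (t * q)"
        by (simp add: q_def power2_eq_square algebra_simps)
      then show ?thesis using t by simp
    qed
    have "(\<lambda>n. inverse (real (Suc n)) * q) \<longlonglongrightarrow> 0 * q"
      by (intro tendsto_intros LIMSEQ_inverse_real_of_nat)
    moreover have "\<forall>n. 2 * ((\<integral>x. (w x)\<^sup>2 \<partial>M) - (\<integral>x. w x * v x \<partial>M)) \<le> inverse (real (Suc n)) * q"
      using key by (simp add: inverse_le_1_iff)
    ultimately have "2 * ((\<integral>x. (w x)\<^sup>2 \<partial>M) - (\<integral>x. w x * v x \<partial>M)) \<le> 0 * q"
      by (intro LIMSEQ_le_const) auto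
    then show ?thesis by simp
  qed
  have w0: "(\<integral>x. (w x)\<^sup>2 \<partial>M) = 0"
  proof -
    obtain c d where cd: "c \<in> C" "d \<in> D" and le: "(\<integral>x. w x * c x \<partial>M) \<le> (\<integral>x. w x * d x \<partial>M)"
      using meet[OF w] by blast
    have B: "0 \<le> B" using order_trans[OF abs_ge_zero bnd[of c undefined]] cd by auto
    have "\<bar>c x\<bar> \<le> 2 * B" "\<bar>d x\<bar> \<le> 2 * B" for x
      using bnd[of c x] bnd[of d x] cd B by auto
    note cd_bnd = this
    have [measurable]: "c \<in> borel_measurable M" "d \<in> borel_measurable M"
      using meas cd by auto
    have i: "integrable M (\<lambda>x. w x * c x)" "integrable M (\<lambda>x. w x * d x)"
      by (rule integrable_bounded[OF _ prod_bnd[OF w(2) cd_bnd(1)]]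
          integrable_bounded[OF _ prod_bnd[OF w(2) cd_bnd(2)]]; measurable)+
    have "(\<integral>x. (w x)\<^sup>2 \<partial>M) \<le> (\<integral>x. w x * (c x - d x) \<partial>M)"
      using cd by (intro var SI)
    also have "\<dots> = (\<integral>x. w x * c x \<partial>M) - (\<integral>x. w x * d x \<partial>M)"
      using i by (simp add: right_diff_distrib)
    finally show ?thesis
      using le by (intro antisym) auto
  qed
  \<comment> \<open>So \<open>0\<close> is in the closure of \<open>C - D\<close>; the elements of \<open>C\<close> that are close to \<open>D\<close> form a nested sequence.\<close>
  define F where "F n = {c \<in> C. \<exists>d\<in>D. (\<integral>x. (c x - d x)\<^sup>2 \<partial>M) \<le> 1 / real (Suc n)}" for n
  have F_ne: "F n \<noteq> {}" for n
  proof -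
    have "(\<lambda>k. \<integral>x. (f k x)\<^sup>2 \<partial>M) \<longlonglongrightarrow> (\<integral>x. (w x)\<^sup>2 \<partial>M)"
    proof (rule integral_bounded_convergence[where B = "(2 * B)\<^sup>2"])
      show "AE x in M. (\<lambda>n. (f n x)\<^sup>2) \<longlonglongrightarrow> (w x)\<^sup>2"
        using lim by eventually_elim (intro tendsto_intros)
    qed (use sq_bnd[OF S_bnd[OF f]] in auto)
    then have "eventually (\<lambda>k. (\<integral>x. (f k x)\<^sup>2 \<partial>M) < 1 / real (Suc n)) sequentially"
      unfolding w0 by (rule order_tendstoD) simp
    then obtain k where k: "(\<integral>x. (f k x)\<^sup>2 \<partial>M) < 1 / real (Suc n)"
      by (auto simp: eventually_sequentially)
    obtain c d where cd: "c \<in> C" "d \<in> D" "f k = (\<lambda>x. c x - d x)"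
      using f[of k] by (auto simp: S_def)
    then have "c \<in> F n" using k by (auto simp: F_def intro!: bexI[of _ d])
    then show ?thesis by auto
  qed
  have F_dec: "F (Suc n) \<subseteq> F n" for n
  proof -
    have "1 / real (Suc (Suc n)) \<le> 1 / real (Suc n)" by (intro divide_left_mono) auto
    then show ?thesis unfolding F_def by (auto intro: order_trans)
  qed
  have F_mid: "(\<lambda>x. (c x + c' x) / 2) \<in> F n" if c: "c \<in> F n" "c' \<in> F n" for c c' n
  proof -
    obtain d d' where d: "d \<in> D" "d' \<in> D" and cC: "c \<in> C" "c' \<in> C"
      and le: "(\<integral>x. (c x - d x)\<^sup>2 \<partial>M) \<le> 1 / real (Suc n)" "(\<integral>x. (c' x - d' x)\<^sup>2 \<partial>M) \<le> 1 / real (Suc n)"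
      using c by (auto simp: F_def)
    have S: "(\<lambda>x. c x - d x) \<in> S" "(\<lambda>x. c' x - d' x) \<in> S" using SI[OF cC(1) d(1)] SI[OF cC(2) d(2)] .
    have i: "integrable M (\<lambda>x. (h x)\<^sup>2)" if "h \<in> S" for h
      using S_meas[OF that] sq_bnd[OF S_bnd[OF that]]
      by (auto intro!: integrable_bounded[where B = "(2 * B)\<^sup>2"])
    have m: "(\<lambda>x. (c x + c' x) / 2) \<in> C" "(\<lambda>x. (d x + d' x) / 2) \<in> D"
      using convex(1)[OF cC, of "1/2"] convex(2)[OF d, of "1/2"] by (simp_all add: field_simps)
    then have Sm: "(\<lambda>x. (c x + c' x) / 2 - (d x + d' x) / 2) \<in> S" by (rule SI)
    have "(\<integral>x. ((c x + c' x) / 2 - (d x + d' x) / 2)\<^sup>2 \<partial>M)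
        \<le> (\<integral>x. (1/2) * (c x - d x)\<^sup>2 + (1/2) * (c' x - d' x)\<^sup>2 \<partial>M)"
    proof (rule integral_mono[OF i[OF Sm]])
      show "integrable M (\<lambda>x. (1/2) * (c x - d x)\<^sup>2 + (1/2) * (c' x - d' x)\<^sup>2)"
        using i[OF S(1)] i[OF S(2)] by auto
      show "((c x + c' x) / 2 - (d x + d' x) / 2)\<^sup>2
          \<le> (1/2) * (c x - d x)\<^sup>2 + (1/2) * (c' x - d' x)\<^sup>2" for x
        using zero_le_power2[of "(c x - d x) - (c' x - d' x)"]
        by (simp add: power2_eq_square field_simps)
    qed
    also have "\<dots> = (1/2) * (\<integral>x. (c x - d x)\<^sup>2 \<partial>M) + (1/2) * (\<integral>x. (c' x - d' x)\<^sup>2 \<partial>M)"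
      using i[OF S(1)] i[OF S(2)] by simp
    also have "\<dots> \<le> 1 / real (Suc n)" using le by simp
    finally show ?thesis using m by (auto simp: F_def)
  qed
  have FC: "g \<in> C" if "g \<in> F n" for g n using that by (simp add: F_def)
  obtain c g where c: "c \<in> borel_measurable M" "\<And>x. \<bar>c x\<bar> \<le> B" and g: "\<And>n. g n \<in> F n"
    and glim: "AE x in M. (\<lambda>n. g n x) \<longlonglongrightarrow> c x"
  proof (rule nested_convex_min_norm[of F B])
    fix c g
    assume "c \<in> borel_measurable M" "\<And>x. \<bar>c x\<bar> \<le> B" "\<And>n. g n \<in> F n"
      "AE x in M. (\<lambda>n. g n x) \<longlonglongrightarrow> c x"
    then show thesis by (rule that)
  qed (rule F_ne F_dec F_mid meas[OF UnI1[OF FC]] bnd[OF UnI1[OF FC]]; assumption)+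
  have cC: "c \<in> C" using closed(1)[OF FC[OF g] c glim] .
  have "\<exists>d\<in>D. (\<integral>x. (g n x - d x)\<^sup>2 \<partial>M) \<le> 1 / real (Suc n)" for n
    using g[of n] by (simp add: F_def)
  then obtain d where d: "\<And>n. d n \<in> D" and dist: "\<And>n. (\<integral>x. (g n x - d n x)\<^sup>2 \<partial>M) \<le> 1 / real (Suc n)"
    by metis
  have gdS: "(\<lambda>x. g n x - d n x) \<in> S" for n using SI[OF FC[OF g] d] .
  have "(\<lambda>n. \<integral>x. norm ((g n x - d n x)\<^sup>2) \<partial>M) \<longlonglongrightarrow> 0"
  proof (rule tendsto_sandwich[OF _ _ tendsto_const LIMSEQ_Suc[OF lim_1_over_n]])
    show "\<forall>\<^sub>F n in sequentially. (\<integral>x. norm ((g n x - d n x)\<^sup>2) \<partial>M) \<le> 1 / real (Suc n)"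
      using dist by simp
  qed auto
  moreover have "integrable M (\<lambda>x. (g n x - d n x)\<^sup>2)" for n
    using S_meas[OF gdS[of n]] sq_bnd[OF S_bnd[OF gdS[of n]]]
    by (auto intro!: integrable_bounded[where B = "(2 * B)\<^sup>2"])
  ultimately obtain r where r: "strict_mono (r :: nat \<Rightarrow> nat)"
    "AE x in M. (\<lambda>n. (g (r n) x - d (r n) x)\<^sup>2) \<longlonglongrightarrow> 0"
    using tendsto_L1_AE_subseq[of M "\<lambda>n x. (g n x - d n x)\<^sup>2"] by auto
  have "AE x in M. (\<lambda>n. d (r n) x) \<longlonglongrightarrow> c x"
    using glim r(2)
  proof eventually_elim
    case (elim x)
    have "(\<lambda>n. g (r n) x - d (r n) x) \<longlonglongrightarrow> 0"
      using tendsto_real_sqrt[OF elim(2)] by (simp add: tendsto_rabs_zero_iff)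
    moreover have "(\<lambda>n. g (r n) x) \<longlonglongrightarrow> c x"
      using LIMSEQ_subseq_LIMSEQ[OF elim(1) r(1)] by (simp add: o_def)
    ultimately show ?case
      using tendsto_diff[of "\<lambda>n. g (r n) x" "c x" _ "\<lambda>n. g (r n) x - d (r n) x" 0] by simp
  qed
  then have "c \<in> D" using closed(2)[of "\<lambda>n. d (r n)" c] d c by blast
  with cC show thesis by (rule that)
qed

end

section \<open>The symmetric joint measure\<close>

locale reversible_walk = finite_measure \<nu>
  for \<nu> :: "'a::polish_space measure" +
  fixes m :: "'a \<Rightarrow> 'a measure"
  assumes sets_nu [simp, measurable_cong]: "sets \<nu> = sets borel"
    and walk: "random_walk m"
    and rev: "reversible m \<nu>"
begin

lemma space_nu [simp]: "space \<nu> = UNIV"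
  using sets_eq_imp_space_eq[OF sets_nu] by simp

lemma borel_measurable_nu [simp]: "borel_measurable \<nu> = borel_measurable borel"
  by (rule measurable_cong_sets) simp_all

lemma sets_m [simp, measurable_cong]: "sets (m x) = sets borel"
  using walk by (simp add: random_walk_def)

lemma space_m [simp]: "space (m x) = UNIV"
  using sets_eq_imp_space_eq[OF sets_m] by simp

lemma prob_m: "prob_space (m x)"
  using walk by (simp add: random_walk_def)

lemma emeasure_m_UNIV [simp]: "emeasure (m x) UNIV = 1"
  using prob_space.emeasure_space_1[OF prob_m, of x] by simp

lemma kernel_m [measurable]: "m \<in> borel \<rightarrow>\<^sub>M subprob_algebra borel"
  using walk prob_m
  by (intro measurable_subprob_algebra)
    (auto simp: random_walk_def intro: prob_space_imp_subprob_space)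

text \<open>
  The measure \<open>dm\<^sub>x(y) d\<nu>(x)\<close> on pairs.  Reversibility says exactly that it is invariant under
  exchanging the coordinates, which is how it enters most of the arguments below.
\<close>

definition joint :: "('a \<times> 'a) measure" where
  "joint = \<nu> \<bind> (\<lambda>x. distr (m x) (borel \<Otimes>\<^sub>M borel) (Pair x))"

lemma kernel_joint [measurable]:
  "(\<lambda>x. distr (m x) (borel \<Otimes>\<^sub>M borel) (Pair x)) \<in> \<nu> \<rightarrow>\<^sub>M subprob_algebra (borel \<Otimes>\<^sub>M borel)"
  by (rule measurable_distr2[where M = borel]) measurable

lemma sets_joint [simp, measurable_cong]: "sets joint = sets (borel \<Otimes>\<^sub>M borel)"
  unfolding joint_def by (rule sets_bind) auto

lemma space_joint [simp]: "space joint = UNIV"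
  using sets_eq_imp_space_eq[OF sets_joint] by (simp add: space_pair_measure)

lemma nn_integral_joint:
  assumes [measurable]: "f \<in> borel_measurable (borel \<Otimes>\<^sub>M borel)"
  shows "(\<integral>\<^sup>+z. f z \<partial>joint) = (\<integral>\<^sup>+x. \<integral>\<^sup>+y. f (x, y) \<partial>m x \<partial>\<nu>)"
  unfolding joint_def
  by (subst nn_integral_bind[where B = "borel \<Otimes>\<^sub>M borel"]) (simp_all add: nn_integral_distr)

lemma finite_measure_joint: "finite_measure joint"
proof
  have "emeasure joint (space joint) = (\<integral>\<^sup>+z. 1 \<partial>joint)" by simp
  also have "\<dots> = emeasure \<nu> UNIV"
    by (subst nn_integral_joint) simp_all
  also have "\<dots> \<noteq> \<infinity>"
    using finite_emeasure_space by simp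
  finally show "emeasure joint (space joint) \<noteq> \<infinity>" .
qed

lemma integral_joint:
  fixes f :: "'a \<times> 'a \<Rightarrow> real"
  assumes [measurable]: "f \<in> borel_measurable (borel \<Otimes>\<^sub>M borel)" and bnd: "\<And>z. \<bar>f z\<bar> \<le> B"
  shows "(\<integral>z. f z \<partial>joint) = (\<integral>x. \<integral>y. f (x, y) \<partial>m x \<partial>\<nu>)"
proof -
  have "(\<integral>z. f z \<partial>joint) = (\<integral>x. \<integral>z. f z \<partial>distr (m x) (borel \<Otimes>\<^sub>M borel) (Pair x) \<partial>\<nu>)"
    unfolding joint_def
  proof (rule integral_bind[where B = B and B' = 1 and K = "borel \<Otimes>\<^sub>M borel"])
    show "AE x in \<nu>. emeasure (distr (m x) (borel \<Otimes>\<^sub>M borel) (Pair x))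
        (space (distr (m x) (borel \<Otimes>\<^sub>M borel) (Pair x))) \<le> ennreal 1"
      by (intro AE_I2)
        (simp add: prob_space.emeasure_space_1[OF prob_space.prob_space_distr[OF prob_m]] del: space_distr)
  qed (use bnd finite_measure_axioms in auto)
  then show ?thesis by (simp add: integral_distr)
qed

lemma measurable_swap [measurable]: "prod.swap \<in> (borel \<Otimes>\<^sub>M borel) \<rightarrow>\<^sub>M (borel \<Otimes>\<^sub>M borel)"
  unfolding prod.swap_def by measurable

lemma joint_swap: "distr joint (borel \<Otimes>\<^sub>M borel) prod.swap = joint"
proof (rule measure_eqI)
  fix C assume "C \<in> sets (distr joint (borel \<Otimes>\<^sub>M borel) prod.swap)"
  then have C [measurable]: "C \<in> sets (borel \<Otimes>\<^sub>M borel)" by simp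
  have "emeasure (distr joint (borel \<Otimes>\<^sub>M borel) prod.swap) C
      = (\<integral>\<^sup>+z. indicator C z \<partial>distr joint (borel \<Otimes>\<^sub>M borel) prod.swap)" by simp
  also have "\<dots> = (\<integral>\<^sup>+z. indicator C (prod.swap z) \<partial>joint)"
  proof (rule nn_integral_distr)
    show "prod.swap \<in> joint \<rightarrow>\<^sub>M borel \<Otimes>\<^sub>M borel"
      using measurable_swap by (simp cong: measurable_cong_sets)
    show "indicator C \<in> borel_measurable (distr joint (borel \<Otimes>\<^sub>M borel) prod.swap)"
      using C by (intro borel_measurable_indicator) simp
  qed
  also have "\<dots> = (\<integral>\<^sup>+y. \<integral>\<^sup>+x. indicator C (x, y) \<partial>m y \<partial>\<nu>)"
    by (subst nn_integral_joint) simp_all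
  also have "\<dots> = (\<integral>\<^sup>+x. \<integral>\<^sup>+y. indicator C (x, y) \<partial>m x \<partial>\<nu>)"
    using rev C unfolding reversible_def by simp
  also have "\<dots> = emeasure joint C"
    by (subst nn_integral_joint[symmetric]) simp_all
  finally show "emeasure (distr joint (borel \<Otimes>\<^sub>M borel) prod.swap) C = emeasure joint C" .
qed simp

lemma integral_joint_swap:
  fixes f :: "'a \<times> 'a \<Rightarrow> real"
  assumes [measurable]: "f \<in> borel_measurable (borel \<Otimes>\<^sub>M borel)"
  shows "(\<integral>z. f (prod.swap z) \<partial>joint) = (\<integral>z. f z \<partial>joint)"
proof -
  have "(\<integral>z. f z \<partial>distr joint (borel \<Otimes>\<^sub>M borel) prod.swap) = (\<integral>z. f (prod.swap z) \<partial>joint)"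
    by (intro integral_distr) measurable
  then show ?thesis by (simp add: joint_swap)
qed

lemma integrable_joint:
  fixes f :: "'a \<times> 'a \<Rightarrow> real"
  assumes "f \<in> borel_measurable (borel \<Otimes>\<^sub>M borel)" "\<And>z. \<bar>f z\<bar> \<le> B"
  shows "integrable joint f"
  using assms
  by (intro finite_measure.integrable_bounded[OF finite_measure_joint])
    (simp_all cong: measurable_cong_sets)

text \<open>
  Reversibility makes \<open>\<nu>\<close> invariant, so a \<open>\<nu>\<close>-null set is \<open>m x\<close>-null for almost every \<open>x\<close>.
  Hence the nonlocal functionals do not see changes on \<open>\<nu>\<close>-null sets, and functions measurable
  for the completion of \<open>\<nu>\<close> may be replaced by Borel ones.
\<close>

lemma AE_kernel:
  assumes "AE x in \<nu>. P x"
  shows "AE x in \<nu>. AE y in m x. P y"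
proof -
  obtain N where N: "{x \<in> space \<nu>. \<not> P x} \<subseteq> N" "emeasure \<nu> N = 0" "N \<in> sets \<nu>"
    using assms by (rule AE_E)
  then have [measurable]: "N \<in> sets borel" by simp
  have C: "UNIV \<times> N \<in> sets (borel \<Otimes>\<^sub>M borel)" by measurable
  have "(\<integral>\<^sup>+x. emeasure (m x) N \<partial>\<nu>) = (\<integral>\<^sup>+x. \<integral>\<^sup>+y. indicator (UNIV \<times> N) (x, y) \<partial>m x \<partial>\<nu>)"
    by (simp add: indicator_times)
  also have "\<dots> = (\<integral>\<^sup>+y. \<integral>\<^sup>+x. indicator (UNIV \<times> N) (x, y) \<partial>m y \<partial>\<nu>)"
    using rev C unfolding reversible_def by blast
  also have "\<dots> = 0"
    using N by (simp add: indicator_times)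
  finally have "AE x in \<nu>. emeasure (m x) N = 0"
    by (subst (asm) nn_integral_0_iff_AE) (auto cong: measurable_cong_sets)
  then show ?thesis
  proof eventually_elim
    case (elim x)
    then show ?case
      using N by (intro AE_I[of _ _ N]) auto
  qed
qed

section \<open>Total variation and perimeter\<close>

text \<open>
  The real-valued total variation, meaningful for bounded Borel functions; there it represents
  \<^const>\<open>total_variation\<close>.
\<close>

definition variation :: "('a \<Rightarrow> real) \<Rightarrow> real" where
  "variation u = (\<integral>z. \<bar>u (snd z) - u (fst z)\<bar> \<partial>joint) / 2"

lemma total_variation_eq_variation:
  assumes [measurable]: "u \<in> borel_measurable borel" and bnd: "\<And>x. \<bar>u x\<bar> \<le> B"
  shows "total_variation m \<nu> u = ennreal (variation u)"
proof -
  have "\<bar>u (snd z) - u (fst z)\<bar> \<le> 2 * B" for z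
    using bnd[of "snd z"] bnd[of "fst z"] by linarith
  then have i: "integrable joint (\<lambda>z. \<bar>u (snd z) - u (fst z)\<bar>)"
    by (intro integrable_joint[where B = "2 * B"]) auto
  have "total_variation m \<nu> u = (\<integral>\<^sup>+z. ennreal \<bar>u (snd z) - u (fst z)\<bar> \<partial>joint) / 2"
    unfolding total_variation_def nn_integral_completion by (subst nn_integral_joint) simp_all
  also have "\<dots> = ennreal (\<integral>z. \<bar>u (snd z) - u (fst z)\<bar> \<partial>joint) / ennreal 2"
    using i by (simp add: nn_integral_eq_integral)
  also have "\<dots> = ennreal (variation u)"
    unfolding variation_def by (rule divide_ennreal) auto
  finally show ?thesis .
qed

lemma variation_nonneg: "0 \<le> variation u"
  by (simp add: variation_def)

lemma variation_scale: "variation (\<lambda>x. a * u x) = \<bar>a\<bar> * variation u"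
  by (simp add: variation_def right_diff_distrib[symmetric] abs_mult)

lemma total_variation_cong:
  assumes "AE x in \<nu>. u x = v x"
  shows "total_variation m \<nu> u = total_variation m \<nu> v"
  unfolding total_variation_def nn_integral_completion
  using assms AE_kernel[OF assms]
  by (intro arg_cong2[where f = "(/)"] nn_integral_cong_AE refl)
    (auto elim!: eventually_elim2 intro!: nn_integral_cong_AE elim: eventually_mono)

text \<open>
  Used for truncations, which reduce square-integrable functions to bounded ones.
\<close>

lemma total_variation_contraction:
  assumes "\<And>s t. \<bar>h s - h t\<bar> \<le> \<bar>s - t\<bar>"
  shows "total_variation m \<nu> (\<lambda>x. h (u x)) \<le> total_variation m \<nu> u"
  unfolding total_variation_def using assms
  by (intro divide_right_mono_ennreal nn_integral_mono ennreal_leI)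

lemma perimeter_cong:
  assumes "AE x in \<nu>. x \<in> E \<longleftrightarrow> x \<in> F"
  shows "perimeter m \<nu> E = perimeter m \<nu> F"
  unfolding perimeter_def nn_integral_completion
proof (rule nn_integral_cong_AE)
  show "AE x in \<nu>. (\<integral>\<^sup>+y\<in>- E. 1 \<partial>m x) * indicator E x = (\<integral>\<^sup>+y\<in>- F. 1 \<partial>m x) * indicator F x"
    using assms AE_kernel[OF assms]
  proof eventually_elim
    case (elim x)
    have "(\<integral>\<^sup>+y\<in>- E. 1 \<partial>m x) = (\<integral>\<^sup>+y\<in>- F. 1 \<partial>m x)"
      using elim(2) by (intro nn_integral_cong_AE) (auto elim!: eventually_mono simp: indicator_def)
    with elim(1) show ?case by (simp add: indicator_def)
  qed
qed

text \<open>
  The total variation counts the pairs that cross the boundary of \<open>E\<close> in either direction; by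
  symmetry of the joint measure both directions contribute equally, which cancels the factor
  \<open>1/2\<close>.
\<close>

lemma perimeter_eq_variation:
  assumes [measurable]: "E \<in> sets borel"
  shows "perimeter m \<nu> E = ennreal (variation (indicator E))"
proof -
  define g :: "'a \<times> 'a \<Rightarrow> real" where "g z = indicator E (fst z) * indicator (- E) (snd z)" for z
  have g [measurable]: "g \<in> borel_measurable (borel \<Otimes>\<^sub>M borel)"
    unfolding g_def by measurable
  have i: "integrable joint g" "integrable joint (\<lambda>z. g (prod.swap z))"
    by (intro integrable_joint[where B = 1]; simp add: g_def indicator_def)+
  have "perimeter m \<nu> E = (\<integral>\<^sup>+x. \<integral>\<^sup>+y. ennreal (g (x, y)) \<partial>m x \<partial>\<nu>)"
    unfolding perimeter_def nn_integral_completion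
  proof (rule nn_integral_cong)
    show "(\<integral>\<^sup>+y\<in>- E. 1 \<partial>m x) * indicator E x = (\<integral>\<^sup>+y. ennreal (g (x, y)) \<partial>m x)" for x
      by (cases "x \<in> E") (auto simp: g_def indicator_def intro!: nn_integral_cong)
  qed
  also have "\<dots> = (\<integral>\<^sup>+z. ennreal (g z) \<partial>joint)"
    by (rule nn_integral_joint[symmetric]) measurable
  also have "\<dots> = ennreal (\<integral>z. g z \<partial>joint)"
    using i(1) by (rule nn_integral_eq_integral) (simp add: g_def)
  also have "(\<integral>z. g z \<partial>joint) = variation (indicator E)"
  proof -
    have "(\<integral>z. \<bar>indicator E (snd z) - indicator E (fst z)\<bar> \<partial>joint) = (\<integral>z. g z + g (prod.swap z) \<partial>joint)"
      by (intro Bochner_Integration.integral_cong) (auto simp: g_def indicator_def)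
    also have "\<dots> = (\<integral>z. g z \<partial>joint) + (\<integral>z. g (prod.swap z) \<partial>joint)"
      using i by (rule Bochner_Integration.integral_add)
    finally show ?thesis
      by (simp add: variation_def integral_joint_swap)
  qed
  finally show ?thesis .
qed

text \<open>
  Minus the divergence of the antisymmetric field \<open>sgn (w y - w x)\<close>: formally the negative of the
  \<open>1\<close>-Laplacian of \<open>w\<close>, and the subgradient of the total variation at \<open>w\<close> that will serve
  as a test element.
\<close>

definition sign_average :: "('a \<Rightarrow> real) \<Rightarrow> 'a \<Rightarrow> real" where
  "sign_average w x = (\<integral>y. sgn (w x - w y) \<partial>m x)"

lemma sign_average_bound: "\<bar>sign_average w x\<bar> \<le> 1"
proof -
  interpret prob_space "m x" by (rule prob_m)
  have "norm (\<integral>y. sgn (w x - w y) \<partial>m x) \<le> (\<integral>y. 1 \<partial>m x)"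
  proof (cases "integrable (m x) (\<lambda>y. sgn (w x - w y))")
    case True
    then have "(\<integral>y. norm (sgn (w x - w y)) \<partial>m x) \<le> (\<integral>y. 1 \<partial>m x)"
      by (intro integral_mono) (auto simp: sgn_if)
    then show ?thesis by (rule order_trans[OF integral_norm_bound])
  qed (simp add: not_integrable_integral_eq)
  then show ?thesis using prob_space by (simp add: sign_average_def)
qed

lemma sign_average_measurable [measurable]:
  assumes [measurable]: "w \<in> borel_measurable borel"
  shows "sign_average w \<in> borel_measurable borel"
proof -
  have "(\<lambda>x. \<integral>z. sgn (w (fst z) - w (snd z)) \<partial>distr (m x) (borel \<Otimes>\<^sub>M borel) (Pair x))
      \<in> borel_measurable \<nu>"
    by (rule measurable_compose[OF kernel_joint integral_measurable_subprob_algebra]) measurable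
  then show ?thesis
    by (simp add: integral_distr sign_average_def[abs_def])
qed

text \<open>
  Integration by parts: symmetrising the integrand \<open>sgn (w x - w y) * v x\<close> under exchange of \<open>x\<close>
  and \<open>y\<close>.
\<close>

lemma integral_sign_average:
  assumes [measurable]: "w \<in> borel_measurable borel" "v \<in> borel_measurable borel"
    and bnd: "\<And>x. \<bar>v x\<bar> \<le> B"
  shows "(\<integral>x. sign_average w x * v x \<partial>\<nu>)
    = (\<integral>z. sgn (w (fst z) - w (snd z)) * (v (fst z) - v (snd z)) \<partial>joint) / 2"
proof -
  define g where "g z = sgn (w (fst z) - w (snd z)) * v (fst z)" for z :: "'a \<times> 'a"
  have [measurable]: "g \<in> borel_measurable (borel \<Otimes>\<^sub>M borel)"
    unfolding g_def by measurable
  have g_bnd: "\<bar>g z\<bar> \<le> B" for z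
    using bnd[of "fst z"] by (auto simp: g_def sgn_if)
  have i: "integrable joint g" "integrable joint (\<lambda>z. g (prod.swap z))"
    by (intro integrable_joint[where B = B] g_bnd; measurable)+
  have "(\<integral>z. sgn (w (fst z) - w (snd z)) * (v (fst z) - v (snd z)) \<partial>joint)
      = (\<integral>z. g z + g (prod.swap z) \<partial>joint)"
    by (intro Bochner_Integration.integral_cong) (auto simp: g_def sgn_if)
  also have "\<dots> = (\<integral>z. g z \<partial>joint) + (\<integral>z. g (prod.swap z) \<partial>joint)"
    using i by (rule Bochner_Integration.integral_add)
  also have "\<dots> = 2 * (\<integral>z. g z \<partial>joint)"
    by (simp add: integral_joint_swap)
  also have "(\<integral>z. g z \<partial>joint) = (\<integral>x. \<integral>y. g (x, y) \<partial>m x \<partial>\<nu>)"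
    using g_bnd by (intro integral_joint) measurable
  also have "\<dots> = (\<integral>x. sign_average w x * v x \<partial>\<nu>)"
    by (simp add: g_def sign_average_def)
  finally show ?thesis by simp
qed

lemma sign_average_le_variation:
  assumes [measurable]: "w \<in> borel_measurable borel" "v \<in> borel_measurable borel"
    and bnd: "\<And>x. \<bar>v x\<bar> \<le> B"
  shows "(\<integral>x. sign_average w x * v x \<partial>\<nu>) \<le> variation v"
proof -
  have d: "\<bar>v (fst z) - v (snd z)\<bar> \<le> 2 * B" for z
    using bnd[of "snd z"] bnd[of "fst z"] by linarith
  have "(\<integral>z. sgn (w (fst z) - w (snd z)) * (v (fst z) - v (snd z)) \<partial>joint)
      \<le> (\<integral>z. \<bar>v (snd z) - v (fst z)\<bar> \<partial>joint)"
  proof (rule integral_mono)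
    show "integrable joint (\<lambda>z. sgn (w (fst z) - w (snd z)) * (v (fst z) - v (snd z)))"
      using d order_trans[OF abs_ge_zero d]
      by (intro integrable_joint[where B = "2 * B"]) (auto simp: sgn_if abs_minus_commute)
    show "integrable joint (\<lambda>z. \<bar>v (snd z) - v (fst z)\<bar>)"
      using d by (intro integrable_joint[where B = "2 * B"]) (auto simp: abs_minus_commute)
  qed (auto simp: sgn_if)
  then show ?thesis
    using integral_sign_average[OF assms] by (simp add: variation_def)
qed

lemma sign_average_attains_variation:
  assumes "w \<in> borel_measurable borel" "\<And>x. \<bar>w x\<bar> \<le> B"
  shows "(\<integral>x. sign_average w x * w x \<partial>\<nu>) = variation w"
proof -
  have "(\<lambda>z. sgn (w (fst z) - w (snd z)) * (w (fst z) - w (snd z))) = (\<lambda>z. \<bar>w (snd z) - w (fst z)\<bar>)"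
    by (auto simp: sgn_if)
  then show ?thesis
    using integral_sign_average[OF assms(1) assms] by (simp add: variation_def)
qed

section \<open>Optimality conditions for the energy\<close>

definition bounded_borel :: "('a \<Rightarrow> real) set" where
  "bounded_borel = {u \<in> borel_measurable borel. \<exists>B. \<forall>x. \<bar>u x\<bar> \<le> B}"

lemma bounded_borelI:
  "u \<in> borel_measurable borel \<Longrightarrow> (\<And>x. \<bar>u x\<bar> \<le> B) \<Longrightarrow> u \<in> bounded_borel"
  by (auto simp: bounded_borel_def)

lemma bounded_borelE:
  assumes "u \<in> bounded_borel"
  obtains B where "u \<in> borel_measurable borel" "\<And>x. \<bar>u x\<bar> \<le> B"
  using assms by (auto simp: bounded_borel_def)

lemma bounded_borel_measurable: "u \<in> bounded_borel \<Longrightarrow> u \<in> borel_measurable borel"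
  by (simp add: bounded_borel_def)

lemma indicator_bounded_borel: "E \<in> sets borel \<Longrightarrow> indicator E \<in> bounded_borel"
  by (rule bounded_borelI[where B = 1]) (auto simp: indicator_def)

lemma bounded_borel_diff:
  assumes "u \<in> bounded_borel" "v \<in> bounded_borel"
  shows "(\<lambda>x. u x - v x) \<in> bounded_borel"
proof -
  obtain A B where [measurable]: "u \<in> borel_measurable borel" "v \<in> borel_measurable borel"
    and *: "\<And>x. \<bar>u x\<bar> \<le> A" "\<And>x. \<bar>v x\<bar> \<le> B"
    using assms by (auto simp: bounded_borel_def)
  show ?thesis
  proof (rule bounded_borelI[where B = "A + B"])
    show "\<bar>u x - v x\<bar> \<le> A + B" for x using *(1)[of x] *(2)[of x] by linarith
  qed measurable
qed

lemma bounded_borel_mult: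
  assumes "u \<in> bounded_borel" "v \<in> bounded_borel"
  shows "(\<lambda>x. u x * v x) \<in> bounded_borel"
proof -
  obtain A B where [measurable]: "u \<in> borel_measurable borel" "v \<in> borel_measurable borel"
    and *: "\<And>x. \<bar>u x\<bar> \<le> A" "\<And>x. \<bar>v x\<bar> \<le> B"
    using assms by (auto simp: bounded_borel_def)
  show ?thesis
  proof (rule bounded_borelI[where B = "A * B"])
    show "\<bar>u x * v x\<bar> \<le> A * B" for x
      unfolding abs_mult using *(1)[of x] *(2)[of x] by (intro mult_mono) auto
  qed measurable
qed

lemma bounded_borel_abs: "u \<in> bounded_borel \<Longrightarrow> (\<lambda>x. \<bar>u x\<bar>) \<in> bounded_borel"
  by (auto simp: bounded_borel_def)

lemma bounded_borel_const: "(\<lambda>x. a) \<in> bounded_borel"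
  by (rule bounded_borelI[where B = "\<bar>a\<bar>"]) auto

lemma integrable_bounded_borel: "u \<in> bounded_borel \<Longrightarrow> integrable \<nu> u"
  by (auto simp: bounded_borel_def intro: integrable_bounded)

lemma bounded_borel_L1: "u \<in> bounded_borel \<Longrightarrow> u \<in> L1 \<nu>"
  using integrable_bounded_borel[of u]
  by (simp add: L1_def integrable_completion bounded_borel_measurable)

lemma total_variation_bounded_borel:
  "u \<in> bounded_borel \<Longrightarrow> total_variation m \<nu> u = ennreal (variation u)"
  by (erule bounded_borelE) (rule total_variation_eq_variation)

lemma energy_cong:
  assumes "AE x in \<nu>. u x = v x" "AE x in \<nu>. f x = g x"
  shows "energy m \<nu> u f l = energy m \<nu> v g l"
proof -
  have "(\<integral>\<^sup>+x. ennreal \<bar>u x - f x\<bar> \<partial>\<nu>) = (\<integral>\<^sup>+x. ennreal \<bar>v x - g x\<bar> \<partial>\<nu>)"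
    by (rule nn_integral_cong_AE) (use assms in eventually_elim, simp)
  then show ?thesis
    unfolding energy_def nn_integral_completion using total_variation_cong[OF assms(1)] by simp
qed

lemma energy_bounded_borel:
  assumes u: "u \<in> bounded_borel" and f: "f \<in> bounded_borel" and l: "0 \<le> l"
  shows "energy m \<nu> u f l = ennreal (variation u + l * (\<integral>x. \<bar>u x - f x\<bar> \<partial>\<nu>))"
proof -
  have "(\<integral>\<^sup>+x. ennreal \<bar>u x - f x\<bar> \<partial>\<nu>) = ennreal (\<integral>x. \<bar>u x - f x\<bar> \<partial>\<nu>)"
    by (intro nn_integral_eq_integral integrable_bounded_borel bounded_borel_abs bounded_borel_diff u f)
      simp
  then show ?thesis
    using l by (simp add: energy_def nn_integral_completion total_variation_bounded_borel[OF u]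
        ennreal_mult ennreal_plus variation_nonneg)
qed

lemma minimizers_cong:
  assumes u: "u \<in> minimizers m \<nu> f l" and uv: "AE x in \<nu>. u x = v x" and fg: "AE x in \<nu>. f x = g x"
    and v: "v \<in> bounded_borel"
  shows "v \<in> minimizers m \<nu> g l"
  using u energy_cong[OF uv fg, of l] energy_cong[OF AE_I2[OF refl] fg, of _ l] bounded_borel_L1[OF v]
  by (simp add: minimizers_def)

lemma minimizers_le:
  assumes "u \<in> minimizers m \<nu> f l" "u \<in> bounded_borel" "f \<in> bounded_borel" "v \<in> bounded_borel" "0 \<le> l"
  shows "variation u + l * (\<integral>x. \<bar>u x - f x\<bar> \<partial>\<nu>) \<le> variation v + l * (\<integral>x. \<bar>v x - f x\<bar> \<partial>\<nu>)"
proof -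
  have "energy m \<nu> u f l \<le> energy m \<nu> v f l"
    using assms(1) bounded_borel_L1[OF assms(4)] by (simp add: minimizers_def)
  then show ?thesis
    using assms by (simp add: energy_bounded_borel ennreal_le_iff variation_nonneg del: ennreal_plus)
qed

text \<open>
  Its integral is minus the right derivative at \<open>t = 0\<close> of the fidelity term
  \<open>\<integral>\<bar>t * w - \<chi>\<^sub>E\<bar> d\<nu>\<close>.
\<close>

definition fidelity_slope :: "'a set \<Rightarrow> ('a \<Rightarrow> real) \<Rightarrow> 'a \<Rightarrow> real" where
  "fidelity_slope E w x = (if x \<in> E then w x else - \<bar>w x\<bar>)"

lemma fidelity_slope_bounded_borel:
  assumes [measurable]: "E \<in> sets borel" and "w \<in> bounded_borel"
  shows "fidelity_slope E w \<in> bounded_borel"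
proof -
  obtain B where [measurable]: "w \<in> borel_measurable borel" and "\<And>x. \<bar>w x\<bar> \<le> B"
    using assms(2) by (auto simp: bounded_borel_def)
  then show ?thesis
    unfolding fidelity_slope_def[abs_def] by (intro bounded_borelI[where B = B]) auto
qed

text \<open>
  The optimality condition for \<open>0\<close> in the direction \<open>w\<close>.  For bounded \<open>w\<close> the fidelity term is
  affine in \<open>t\<close> as long as \<open>t * \<bar>w\<bar> \<le> 1\<close>, and the total variation is homogeneous, so that
  comparing \<open>0\<close> with one competitor \<open>t * w\<close> already gives the derivative exactly.
\<close>

lemma zero_minimizer_imp_slope_le:
  assumes E: "E \<in> sets borel" and l: "0 < l"
    and zero: "(\<lambda>x. 0) \<in> minimizers m \<nu> (indicator E) l" and w: "w \<in> bounded_borel"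
  shows "l * (\<integral>x. fidelity_slope E w x \<partial>\<nu>) \<le> variation w"
proof -
  obtain B where B: "\<And>x. \<bar>w x\<bar> \<le> B" using w by (auto simp: bounded_borel_def)
  define t where "t = 1 / (1 + B)"
  have B0: "0 \<le> B" using order_trans[OF abs_ge_zero B] .
  then have t: "0 < t" by (simp add: t_def)
  have tw: "\<bar>t * w x\<bar> \<le> 1" for x
    using B[of x] B0 by (simp add: t_def field_simps abs_mult)
  have twb: "(\<lambda>x. t * w x) \<in> bounded_borel"
    using w by (intro bounded_borel_mult bounded_borel_const)
  have iE: "integrable \<nu> (indicator E :: 'a \<Rightarrow> real)"
    by (intro integrable_bounded_borel indicator_bounded_borel E)
  have "\<bar>t * w x - indicator E x\<bar> = indicator E x - t * fidelity_slope E w x" for x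
    using abs_le_D1[OF tw[of x]] t by (auto simp: fidelity_slope_def indicator_def abs_mult)
  then have eq: "(\<integral>x. \<bar>t * w x - indicator E x\<bar> \<partial>\<nu>) = (\<integral>x. indicator E x \<partial>\<nu>) - t * (\<integral>x. fidelity_slope E w x \<partial>\<nu>)"
    using iE integrable_bounded_borel[OF fidelity_slope_bounded_borel[OF E w]] by simp
  have "l * (\<integral>x. indicator E x \<partial>\<nu>) \<le> t * variation w
      + l * ((\<integral>x. indicator E x \<partial>\<nu>) - t * (\<integral>x. fidelity_slope E w x \<partial>\<nu>))"
    using minimizers_le[OF zero bounded_borel_const indicator_bounded_borel[OF E] twb] l t
      variation_scale[of 0 "\<lambda>x. 0"]
    by (simp add: eq variation_scale)
  then have "t * (l * (\<integral>x. fidelity_slope E w x \<partial>\<nu>)) \<le> t * variation w"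
    by (simp add: algebra_simps)
  then show ?thesis using t by simp
qed

lemma indicator_minimizer_imp_variation_le:
  assumes E: "E \<in> sets borel" and l: "0 < l"
    and min: "indicator E \<in> minimizers m \<nu> (indicator E) l"
  shows "variation (indicator E) \<le> l * measure \<nu> E"
  using minimizers_le[OF min indicator_bounded_borel[OF E] indicator_bounded_borel[OF E]
      bounded_borel_const[of 0]] l E variation_scale[of 0 "\<lambda>x. 0"]
  by simp

section \<open>Subgradients of the total variation\<close>

text \<open>
  The optimality condition for \<open>0\<close> bounds \<open>l * \<integral> fidelity_slope E w\<close> by the variation for each direction \<open>w\<close>
  separately; duality turns this into a single function \<open>c\<close> working for all
  directions.  The set \<open>C\<close> consists of the functions \<open>l * \<xi>\<close> with \<open>\<xi>\<close> a sign selection of \<open>\<chi>\<^sub>E\<close>, the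
  set \<open>D\<close> of the bounded subgradients of the total variation at \<open>0\<close>.  For given \<open>w\<close>, the minimum of
  \<open>\<integral> w c\<close> over \<open>C\<close> is \<open>l * \<integral> fidelity_slope E w\<close>, and \<^const>\<open>sign_average\<close> shows that the maximum
  of \<open>\<integral> w d\<close> over \<open>D\<close> is the variation of \<open>w\<close>.  So the hypothesis says that no \<open>w\<close> separates \<open>C\<close>
  from \<open>D\<close>.
\<close>

lemma exists_calibration:
  assumes E [measurable]: "E \<in> sets borel" and l: "0 \<le> l"
    and slope: "\<And>w. w \<in> bounded_borel \<Longrightarrow> l * (\<integral>x. fidelity_slope E w x \<partial>\<nu>) \<le> variation w"
  obtains c where "c \<in> bounded_borel" "AE x in \<nu>. x \<in> E \<longrightarrow> c x = l" "AE x in \<nu>. \<bar>c x\<bar> \<le> l"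
    "\<And>v. v \<in> bounded_borel \<Longrightarrow> (\<integral>x. c x * v x \<partial>\<nu>) \<le> variation v"
proof -
  \<comment> \<open>A common bound: \<open>l\<close> suffices for \<open>C\<close>, and \<open>1\<close> for the functions \<^const>\<open>sign_average\<close> in \<open>D\<close>.\<close>
  define K where "K = max l 1"
  define C where "C = {c \<in> borel_measurable borel. (\<forall>x. \<bar>c x\<bar> \<le> K) \<and>
    (AE x in \<nu>. (x \<in> E \<longrightarrow> c x = l) \<and> \<bar>c x\<bar> \<le> l)}"
  define D where "D = {d \<in> borel_measurable borel. (\<forall>x. \<bar>d x\<bar> \<le> K) \<and>
    (\<forall>v\<in>bounded_borel. (\<integral>x. d x * v x \<partial>\<nu>) \<le> variation v)}"
  have CD_bb: "f \<in> bounded_borel" if "f \<in> C \<union> D" for f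
    using that by (auto simp: C_def D_def intro: bounded_borelI[where B = K])
  have combo: "\<bar>(1 - t) * a + t * b\<bar> \<le> k" if "\<bar>a\<bar> \<le> k" "\<bar>b\<bar> \<le> k" "0 \<le> t" "t \<le> 1" for a b t k :: real
  proof -
    have "\<bar>(1 - t) * a + t * b\<bar> \<le> (1 - t) * \<bar>a\<bar> + t * \<bar>b\<bar>"
      using that by (intro order_trans[OF abs_triangle_ineq]) (simp add: abs_mult)
    also have "\<dots> \<le> k" using that by (intro convex_bound_le) auto
    finally show ?thesis .
  qed
  have sgn_mem: "sign_average w \<in> D" if "w \<in> bounded_borel" for w
  proof -
    have "\<bar>sign_average w x\<bar> \<le> K" for x using sign_average_bound[of w x] by (simp add: K_def)
    then show ?thesis
      using bounded_borel_measurable[OF that] sign_average_le_variation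
      by (auto simp: D_def bounded_borel_def)
  qed
  define opt where "opt w x = (if x \<in> E then l else - l * sgn (w x))" for w :: "'a \<Rightarrow> real" and x
  have opt_mem: "opt w \<in> C" if "w \<in> bounded_borel" for w
  proof -
    have [measurable]: "w \<in> borel_measurable borel" using that by (rule bounded_borel_measurable)
    have "opt w \<in> borel_measurable borel" unfolding opt_def[abs_def] by measurable
    then show ?thesis using l by (auto simp: C_def opt_def K_def sgn_if)
  qed
  obtain c where "c \<in> C" "c \<in> D"
  proof (rule AE_closed_convex_meet[of C D K])
    show "C \<noteq> {}" using opt_mem[OF bounded_borel_const[of 0]] by auto
    show "D \<noteq> {}" using sgn_mem[OF bounded_borel_const[of 0]] by auto
  next
    fix c c' t assume *: "c \<in> C" "c' \<in> C" and t: "0 \<le> t" "t \<le> (1::real)"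
    have "AE x in \<nu>. (x \<in> E \<longrightarrow> (1 - t) * c x + t * c' x = l) \<and> \<bar>(1 - t) * c x + t * c' x\<bar> \<le> l"
    proof -
      have "AE x in \<nu>. (x \<in> E \<longrightarrow> c x = l) \<and> \<bar>c x\<bar> \<le> l" "AE x in \<nu>. (x \<in> E \<longrightarrow> c' x = l) \<and> \<bar>c' x\<bar> \<le> l"
        using * by (auto simp: C_def)
      then show ?thesis
      proof eventually_elim
        case (elim x)
        then show ?case
          using combo[of "c x" l "c' x" t] t by (auto simp: left_diff_distrib)
      qed
    qed
    with * t combo show "(\<lambda>x. (1 - t) * c x + t * c' x) \<in> C" by (auto simp: C_def)
  next
    fix d d' t assume *: "d \<in> D" "d' \<in> D" and t: "0 \<le> t" "t \<le> (1::real)"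
    have "(\<integral>x. ((1 - t) * d x + t * d' x) * v x \<partial>\<nu>) \<le> variation v" if v: "v \<in> bounded_borel" for v
    proof -
      have i: "integrable \<nu> (\<lambda>x. d x * v x)" "integrable \<nu> (\<lambda>x. d' x * v x)"
        using CD_bb[of d] CD_bb[of d'] * v by (auto intro: integrable_bounded_borel bounded_borel_mult)
      have "(\<integral>x. ((1 - t) * d x + t * d' x) * v x \<partial>\<nu>) = (\<integral>x. (1 - t) * (d x * v x) + t * (d' x * v x) \<partial>\<nu>)"
        by (simp add: algebra_simps)
      also have "\<dots> = (1 - t) * (\<integral>x. d x * v x \<partial>\<nu>) + t * (\<integral>x. d' x * v x \<partial>\<nu>)"
        using i by simp
      also have "\<dots> \<le> variation v"
        using * t v by (intro convex_bound_le) (auto simp: D_def)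
      finally show ?thesis .
    qed
    with * t combo show "(\<lambda>x. (1 - t) * d x + t * d' x) \<in> D" by (auto simp: D_def)
  next
    fix f assume "f \<in> C \<union> D"
    then show "f \<in> borel_measurable \<nu>" by (auto simp: C_def D_def)
    from \<open>f \<in> C \<union> D\<close> show "\<bar>f x\<bar> \<le> K" for x by (auto simp: C_def D_def)
  next
    fix f g assume f: "\<And>n::nat. f n \<in> C" and g: "g \<in> borel_measurable \<nu>" "\<And>x. \<bar>g x\<bar> \<le> K"
      and lim: "AE x in \<nu>. (\<lambda>n. f n x) \<longlonglongrightarrow> g x"
    have "AE x in \<nu>. \<forall>n. (x \<in> E \<longrightarrow> f n x = l) \<and> \<bar>f n x\<bar> \<le> l"
      using f by (intro AE_all_countable[THEN iffD2]) (auto simp: C_def)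
    with lim have "AE x in \<nu>. (x \<in> E \<longrightarrow> g x = l) \<and> \<bar>g x\<bar> \<le> l"
    proof eventually_elim
      case (elim x)
      then show ?case
        using LIMSEQ_unique[of "\<lambda>n. f n x" "g x" l] tendsto_const[of l sequentially]
          LIMSEQ_le_const2[OF tendsto_rabs[OF elim(1)], of l] by auto
    qed
    with g show "g \<in> C" by (simp add: C_def)
  next
    fix f g assume f: "\<And>n::nat. f n \<in> D" and g: "g \<in> borel_measurable \<nu>" "\<And>x. \<bar>g x\<bar> \<le> K"
      and lim: "AE x in \<nu>. (\<lambda>n. f n x) \<longlonglongrightarrow> g x"
    have "(\<integral>x. g x * v x \<partial>\<nu>) \<le> variation v" if v: "v \<in> bounded_borel" for v
    proof (rule LIMSEQ_le_const2)
      obtain B where B: "v \<in> borel_measurable borel" "\<And>x. \<bar>v x\<bar> \<le> B" using v by (auto simp: bounded_borel_def)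
      have fK: "f n \<in> borel_measurable borel" "\<bar>f n x\<bar> \<le> K" for n x using f[of n] by (auto simp: D_def)
      show "(\<lambda>n. \<integral>x. f n x * v x \<partial>\<nu>) \<longlonglongrightarrow> (\<integral>x. g x * v x \<partial>\<nu>)"
      proof (rule integral_bounded_convergence[where B = "K * B"])
        show "\<bar>f n x * v x\<bar> \<le> K * B" for n x
          unfolding abs_mult using fK(2)[of n x] B(2)[of x] by (intro mult_mono) (auto simp: K_def)
        show "AE x in \<nu>. (\<lambda>n. f n x * v x) \<longlonglongrightarrow> g x * v x"
          using lim by eventually_elim (intro tendsto_intros)
      qed (use fK(1) B(1) g(1) in auto)
      show "\<exists>N. \<forall>n\<ge>N. (\<integral>x. f n x * v x \<partial>\<nu>) \<le> variation v"
        using f v by (auto simp: D_def)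
    qed
    with g show "g \<in> D" by (simp add: D_def)
  next
    fix w A assume "w \<in> borel_measurable \<nu>" "\<And>x. \<bar>w x\<bar> \<le> (A::real)"
    then have w: "w \<in> bounded_borel" "w \<in> borel_measurable borel" "\<And>x. \<bar>w x\<bar> \<le> A"
      by (auto intro: bounded_borelI)
    have "(\<integral>x. w x * opt w x \<partial>\<nu>) = (\<integral>x. l * fidelity_slope E w x \<partial>\<nu>)"
      by (intro Bochner_Integration.integral_cong) (auto simp: opt_def fidelity_slope_def sgn_if)
    also have "\<dots> = l * (\<integral>x. fidelity_slope E w x \<partial>\<nu>)"
      by simp
    also have "\<dots> \<le> variation w" by (rule slope[OF w(1)])
    also have "\<dots> = (\<integral>x. w x * sign_average w x \<partial>\<nu>)"
      using sign_average_attains_variation[OF w(2,3)] by (simp add: mult.commute)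
    finally show "\<exists>c\<in>C. \<exists>d\<in>D. (\<integral>x. w x * c x \<partial>\<nu>) \<le> (\<integral>x. w x * d x \<partial>\<nu>)"
      using opt_mem[OF w(1)] sgn_mem[OF w(1)] by blast
  qed
  then show thesis
    using CD_bb[of c] by (intro that[of c]) (auto simp: C_def D_def elim: eventually_mono)
qed

lemma L2_integrable:
  assumes "w \<in> L2 \<nu>"
  obtains v where "v \<in> borel_measurable borel" "AE x in \<nu>. w x = v x" "integrable \<nu> v"
proof -
  have w: "w \<in> borel_measurable (completion \<nu>)" and w2: "integrable (completion \<nu>) (\<lambda>x. (w x)\<^sup>2)"
    using assms by (auto simp: L2_def)
  obtain v where v: "v \<in> borel_measurable borel" "AE x in \<nu>. w x = v x"
    using completion_ex_borel_measurable_real[OF w] by auto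
  have v2: "integrable \<nu> (\<lambda>x. (v x)\<^sup>2)"
  proof -
    have "integrable (completion \<nu>) (\<lambda>x. (v x)\<^sup>2)"
      using v w w2 by (subst integrable_cong_AE[where g = "\<lambda>x. (w x)\<^sup>2"])
        (auto simp: AE_completion_iff intro!: measurable_completion elim: eventually_mono)
    then show ?thesis using v by (subst (asm) integrable_completion) auto
  qed
  have "integrable \<nu> v"
  proof (rule Bochner_Integration.integrable_bound[of _ "\<lambda>x. 1 + (v x)\<^sup>2"])
    have "\<bar>s\<bar> \<le> 1 + s\<^sup>2" for s :: real
      using zero_le_power2[of "\<bar>s\<bar> - 1"] by (simp add: power2_diff)
    then show "AE x in \<nu>. norm (v x) \<le> norm (1 + (v x)\<^sup>2)" by simp
  qed (use v v2 in auto)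
  with v show thesis by (rule that)
qed

text \<open>
  The subgradient inequality passes from bounded to square-integrable functions by truncation,
  since truncation does not increase the total variation.
\<close>

lemma calibration_le_total_variation:
  assumes c: "c \<in> bounded_borel"
    and cal: "\<And>v. v \<in> bounded_borel \<Longrightarrow> (\<integral>x. c x * v x \<partial>\<nu>) \<le> variation v"
    and w: "w \<in> L2 \<nu>"
  shows "ereal (\<integral>x. c x * w x \<partial>completion \<nu>) \<le> enn2ereal (total_variation m \<nu> w)"
proof -
  obtain v where v [measurable]: "v \<in> borel_measurable borel" and wv: "AE x in \<nu>. w x = v x"
    and iv: "integrable \<nu> v"
    using w by (rule L2_integrable)
  obtain B where [measurable]: "c \<in> borel_measurable borel" and B: "\<And>x. \<bar>c x\<bar> \<le> B"
    using c by (auto simp: bounded_borel_def)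
  define h where "h n s = max (- real n) (min (real n) s)" for n s
  have "(\<lambda>n. \<integral>x. c x * h n (v x) \<partial>\<nu>) \<longlonglongrightarrow> (\<integral>x. c x * v x \<partial>\<nu>)"
  proof (rule integral_dominated_convergence[where w = "\<lambda>x. B * \<bar>v x\<bar>"])
    show "AE x in \<nu>. (\<lambda>n. c x * h n (v x)) \<longlonglongrightarrow> c x * v x"
    proof (intro AE_I2 tendsto_mult tendsto_const tendsto_eventually)
      fix x
      obtain N where "\<bar>v x\<bar> \<le> real N" using real_arch_simple by blast
      then show "eventually (\<lambda>n. h n (v x) = v x) sequentially"
        by (intro eventually_sequentiallyI[of N]) (auto simp: h_def)
    qed
    show "AE x in \<nu>. norm (c x * h n (v x)) \<le> B * \<bar>v x\<bar>" for n
    proof (rule AE_I2)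
      fix x
      have "\<bar>h n (v x)\<bar> \<le> \<bar>v x\<bar>" by (auto simp: h_def)
      then show "norm (c x * h n (v x)) \<le> B * \<bar>v x\<bar>"
        using B[of x] unfolding real_norm_def abs_mult by (intro mult_mono) auto
    qed
  qed (use iv in \<open>auto simp: h_def\<close>)
  then have "(\<lambda>n. ennreal (\<integral>x. c x * h n (v x) \<partial>\<nu>)) \<longlonglongrightarrow> ennreal (\<integral>x. c x * v x \<partial>\<nu>)"
    by (rule tendsto_ennrealI)
  moreover have "ennreal (\<integral>x. c x * h n (v x) \<partial>\<nu>) \<le> total_variation m \<nu> w" for n
  proof -
    have bb: "(\<lambda>x. h n (v x)) \<in> bounded_borel"
      by (rule bounded_borelI[where B = "real n"]) (auto simp: h_def)
    have "ennreal (\<integral>x. c x * h n (v x) \<partial>\<nu>) \<le> total_variation m \<nu> (\<lambda>x. h n (v x))"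
      unfolding total_variation_bounded_borel[OF bb] by (intro ennreal_leI cal bb)
    also have "\<dots> \<le> total_variation m \<nu> v"
      by (rule total_variation_contraction) (auto simp: h_def)
    also have "\<dots> = total_variation m \<nu> w"
      using total_variation_cong[OF wv] by simp
    finally show ?thesis .
  qed
  ultimately have "ennreal (\<integral>x. c x * v x \<partial>\<nu>) \<le> total_variation m \<nu> w"
    by (intro LIMSEQ_le_const2) auto
  moreover have "(\<integral>x. c x * w x \<partial>completion \<nu>) = (\<integral>x. c x * v x \<partial>\<nu>)"
  proof -
    have "(\<integral>x. c x * w x \<partial>completion \<nu>) = (\<integral>x. c x * v x \<partial>completion \<nu>)"
    proof (rule integral_cong_AE)
      show "AE x in completion \<nu>. c x * w x = c x * v x"
        using wv by (auto simp: AE_completion_iff elim: eventually_mono)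
      have "c \<in> borel_measurable (completion \<nu>)" by (rule measurable_completion) simp
      then show "(\<lambda>x. c x * w x) \<in> borel_measurable (completion \<nu>)"
        using w by (auto simp: L2_def)
      show "(\<lambda>x. c x * v x) \<in> borel_measurable (completion \<nu>)"
        by (rule measurable_completion) simp
    qed
    also have "\<dots> = (\<integral>x. c x * v x \<partial>\<nu>)" by (rule integral_completion) simp
    finally show ?thesis .
  qed
  ultimately have "enn2ereal (ennreal (\<integral>x. c x * w x \<partial>completion \<nu>)) \<le> enn2ereal (total_variation m \<nu> w)"
    by (simp add: less_eq_ennreal.rep_eq)
  then show ?thesis
    by (rule order_trans[rotated]) (cases "0 \<le> (\<integral>x. c x * w x \<partial>completion \<nu>)";
        simp add: enn2ereal_ennreal ennreal_neg zero_ennreal.rep_eq)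
qed

text \<open>
  Reduction from \<open>\<nu>\<close>-measurable sets to Borel sets.
\<close>

lemma perimeter_ratio_main_part:
  assumes "E \<in> sets (completion \<nu>)"
  shows "perimeter_ratio m \<nu> E = variation (indicator (main_part \<nu> E)) / measure \<nu> (main_part \<nu> E)"
proof -
  have "AE x in \<nu>. x \<in> E \<longleftrightarrow> x \<in> main_part \<nu> E"
    using AE_in_main_part[OF assms] by (auto elim: eventually_mono)
  then have "perimeter m \<nu> E = ennreal (variation (indicator (main_part \<nu> E)))"
    using perimeter_eq_variation[of "main_part \<nu> E"] main_part_sets[OF assms] perimeter_cong by simp
  then show ?thesis
    using assms by (simp add: perimeter_ratio_def variation_nonneg measure_def)
qed

end

section \<open>The thresholding parameter\<close>

theorem proposition3p35:
  fixes m :: "'a::polish_space \<Rightarrow> 'a measure" and \<nu> :: "'a measure"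
    and \<Omega> :: "'a set" and lstar :: real
  assumes "random_walk m"
    and "finite_measure \<nu>" and "sets \<nu> = sets borel" and "emeasure \<nu> UNIV \<noteq> 0"
    and "reversible m \<nu>" and "ergodic m \<nu>"
    and "\<Omega> \<in> sets (completion \<nu>)"
    and "0 < measure (completion \<nu>) \<Omega>"
    and "measure (completion \<nu>) \<Omega> < measure (completion \<nu>) UNIV"
    and "lstar > 0"
    and "\<And>l. 0 < l \<Longrightarrow> l < lstar \<Longrightarrow> (\<lambda>x. 0) \<in> minimizers m \<nu> (indicator \<Omega>) l"
    and "\<And>l. l > lstar \<Longrightarrow> indicator \<Omega> \<in> minimizers m \<nu> (indicator \<Omega>) l"
  shows "threshold m \<nu> \<Omega> = lstar \<and> lstar = perimeter_ratio m \<nu> \<Omega> \<and>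
     eigenpair m \<nu> (perimeter_ratio m \<nu> \<Omega>) (\<lambda>x. 1 / measure (completion \<nu>) \<Omega> * indicator \<Omega> x) \<and>
     calibrable m \<nu> \<Omega>"
proof -
  interpret reversible_walk \<nu> m
    using assms(1-3,5) by (simp add: reversible_walk_def reversible_walk_axioms_def)
  define E where "E = main_part \<nu> \<Omega>"
  define \<mu> where "\<mu> = measure (completion \<nu>) \<Omega>"
  have E [measurable]: "E \<in> sets borel"
    using main_part_sets[OF assms(7)] by (simp add: E_def)
  have \<mu>_E: "\<mu> = measure \<nu> E"
    using assms(7) by (simp add: \<mu>_def E_def measure_def)
  have \<mu>: "0 < \<mu>" using assms(8) by (simp add: \<mu>_def)
  have AE_E: "AE x in \<nu>. x \<in> \<Omega> \<longleftrightarrow> x \<in> E"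
    unfolding E_def using AE_in_main_part[OF assms(7)] by (auto elim: eventually_mono)
  then have AE_ind: "AE x in \<nu>. indicator \<Omega> x = (indicator E x :: real)"
    by (auto elim!: eventually_mono simp: indicator_def)
  have indE: "indicator E \<in> bounded_borel" by (rule indicator_bounded_borel[OF E])

  \<comment> \<open>Both hypotheses survive at the threshold itself, by letting \<open>l\<close> tend to it from either side.\<close>
  have slope_le: "lstar * (\<integral>x. fidelity_slope E w x \<partial>\<nu>) \<le> variation w" if w: "w \<in> bounded_borel" for w
  proof (rule tendsto_le[of "at_left lstar"])
    show "((\<lambda>l. l * (\<integral>x. fidelity_slope E w x \<partial>\<nu>)) \<longlongrightarrow> lstar * (\<integral>x. fidelity_slope E w x \<partial>\<nu>)) (at_left lstar)"
      by (intro tendsto_intros)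
    have "eventually (\<lambda>l. l \<in> {0<..<lstar}) (at_left lstar)"
      using assms(10) by (rule eventually_at_left_real)
    then show "eventually (\<lambda>l. l * (\<integral>x. fidelity_slope E w x \<partial>\<nu>) \<le> variation w) (at_left lstar)"
    proof eventually_elim
      case (elim l)
      then have "(\<lambda>x. 0) \<in> minimizers m \<nu> (indicator E) l"
        by (intro minimizers_cong[OF assms(11) AE_I2[OF refl] AE_ind bounded_borel_const]) auto
      then show ?case using elim w by (intro zero_minimizer_imp_slope_le[OF E]) auto
    qed
  qed (auto simp: trivial_limit_at_left_real)

  have ind_le: "variation (indicator E) \<le> l * \<mu>"
    if "0 < l" "indicator \<Omega> \<in> minimizers m \<nu> (indicator \<Omega>) l" for l
    unfolding \<mu>_E using that(1) minimizers_cong[OF that(2) AE_ind AE_ind indE]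
    by (intro indicator_minimizer_imp_variation_le[OF E])

  have var_E: "variation (indicator E) = lstar * \<mu>"
  proof (rule antisym)
    show "variation (indicator E) \<le> lstar * \<mu>"
    proof (rule tendsto_le[of "at_right lstar"])
      show "((\<lambda>l. l * \<mu>) \<longlongrightarrow> lstar * \<mu>) (at_right lstar)" by (intro tendsto_intros)
      show "eventually (\<lambda>l. variation (indicator E) \<le> l * \<mu>) (at_right lstar)"
        using eventually_at_right_less[of lstar]
      proof eventually_elim
        case (elim l)
        then show ?case using assms(10,12) by (intro ind_le) auto
      qed
    qed (auto simp: trivial_limit_at_right_real)
    have "fidelity_slope E (indicator E) = indicator E" by (auto simp: fidelity_slope_def indicator_def)
    then show "lstar * \<mu> \<le> variation (indicator E)"
      using slope_le[OF indE] by (simp add: \<mu>_E)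
  qed

  have ratio: "perimeter_ratio m \<nu> \<Omega> = lstar"
    using perimeter_ratio_main_part[OF assms(7)] \<mu> by (simp add: E_def[symmetric] var_E \<mu>_E[symmetric])

  have threshold: "threshold m \<nu> \<Omega> = lstar"
  proof -
    let ?T = "{l. 0 < l \<and> indicator \<Omega> \<in> minimizers m \<nu> (indicator \<Omega>) l}"
    have lower: "lstar \<le> l" if "l \<in> ?T" for l
      using ind_le[of l] that \<mu> by (simp add: var_E)
    have mem: "l \<in> ?T" if "lstar < l" for l
      using that assms(10,12) by auto
    have "Inf ?T \<le> l" if "lstar < l" for l
      using mem[OF that] lower by (intro cInf_lower bdd_belowI[where m = lstar])
    then have "Inf ?T \<le> lstar" by (rule dense_ge)
    moreover have "lstar \<le> Inf ?T"
      using mem[of "lstar + 1"] lower by (intro cInf_greatest) auto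
    ultimately show ?thesis by (simp add: threshold_def)
  qed

  have "calibrable m \<nu> \<Omega>"
    unfolding calibrable_def
  proof (rule cInf_eq_minimum[symmetric])
    show "perimeter_ratio m \<nu> \<Omega> \<in> {perimeter_ratio m \<nu> F | F.
        F \<subseteq> \<Omega> \<and> F \<in> sets (completion \<nu>) \<and> measure (completion \<nu>) F > 0}"
      using assms(7,8) by blast
    fix r assume "r \<in> {perimeter_ratio m \<nu> F | F.
        F \<subseteq> \<Omega> \<and> F \<in> sets (completion \<nu>) \<and> measure (completion \<nu>) F > 0}"
    then obtain F where F: "F \<subseteq> \<Omega>" "F \<in> sets (completion \<nu>)" "measure (completion \<nu>) F > 0"
      and r: "r = perimeter_ratio m \<nu> F" by blast
    define G where "G = main_part \<nu> F"
    have G [measurable]: "G \<in> sets borel" using main_part_sets[OF F(2)] by (simp add: G_def)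
    have G_pos: "0 < measure \<nu> G" using F(2,3) by (simp add: G_def measure_def)
    have "G \<subseteq> \<Omega>" using main_part_null_part_Un[OF F(2)] F(1) by (auto simp: G_def)
    then have "(\<integral>x. fidelity_slope E (indicator G) x \<partial>\<nu>) = (\<integral>x. indicator G x \<partial>\<nu>)"
      using AE_E bounded_borel_measurable[OF fidelity_slope_bounded_borel[OF E indicator_bounded_borel[OF G]]]
      by (intro integral_cong_AE) (auto elim!: eventually_mono simp: fidelity_slope_def indicator_def)
    then have "lstar * measure \<nu> G \<le> variation (indicator G)"
      using slope_le[OF indicator_bounded_borel[OF G]] by simp
    then show "perimeter_ratio m \<nu> \<Omega> \<le> r"
      using G_pos by (simp add: ratio r perimeter_ratio_main_part[OF F(2)] G_def[symmetric] pos_le_divide_eq)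
  qed

  moreover have "eigenpair m \<nu> lstar (\<lambda>x. 1 / \<mu> * indicator \<Omega> x)"
  proof -
    let ?u = "\<lambda>x. 1 / \<mu> * indicator \<Omega> x :: real"
    obtain c where c: "c \<in> bounded_borel" and c_E: "AE x in \<nu>. x \<in> E \<longrightarrow> c x = lstar"
      and c_le: "AE x in \<nu>. \<bar>c x\<bar> \<le> lstar"
      and cal: "\<And>v. v \<in> bounded_borel \<Longrightarrow> (\<integral>x. c x * v x \<partial>\<nu>) \<le> variation v"
      using exists_calibration[OF E less_imp_le[OF assms(10)] slope_le] by blast
    have L2_bb: "v \<in> L2 \<nu>" if "v \<in> bounded_borel" for v
      using bounded_borel_measurable[OF that] integrable_bounded_borel[OF bounded_borel_mult[OF that that]]
      by (simp add: L2_def measurable_completion integrable_completion power2_eq_square)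
    have \<Omega>_sets [measurable]: "\<Omega> \<in> sets (completion \<nu>)" by (rule assms(7))
    interpret comp: finite_measure "completion \<nu>"
      using finite_emeasure_space by (intro finite_measureI) simp
    have u_L2: "?u \<in> L2 \<nu>"
      by (auto simp: L2_def indicator_def power2_eq_square intro!: comp.integrable_bounded[where B = "(1 / \<mu>)\<^sup>2"])
    have int_u: "(\<integral>x. ?u x \<partial>completion \<nu>) = 1"
      using \<mu> by (simp add: \<mu>_def)
    have tv_u: "total_variation m \<nu> ?u = ennreal lstar"
    proof -
      have "total_variation m \<nu> ?u = total_variation m \<nu> (\<lambda>x. 1 / \<mu> * indicator E x)"
        using AE_ind by (intro total_variation_cong) (auto elim: eventually_mono)
      also have "\<dots> = ennreal (variation (\<lambda>x. 1 / \<mu> * indicator E x))"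
        by (intro total_variation_bounded_borel bounded_borel_mult bounded_borel_const indE)
      also have "\<dots> = ennreal lstar"
        unfolding variation_scale var_E using \<mu> by simp
      finally show ?thesis .
    qed
    have c_meas [measurable]: "c \<in> borel_measurable (completion \<nu>)"
      using bounded_borel_measurable[OF c] by (intro measurable_completion) simp
    have cu: "(\<integral>x. c x * ?u x \<partial>completion \<nu>) = lstar"
    proof -
      have "(\<integral>x. c x * ?u x \<partial>completion \<nu>) = (\<integral>x. lstar * ?u x \<partial>completion \<nu>)"
      proof (rule integral_cong_AE)
        show "AE x in completion \<nu>. c x * ?u x = lstar * ?u x"
          unfolding AE_completion_iff using AE_E c_E by eventually_elim (auto simp: indicator_def)
      qed measurable
      then show ?thesis using int_u by simp
    qed
    have "(\<lambda>x. c x / lstar) \<in> sign_selections \<nu> ?u"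
    proof -
      have "AE x in \<nu>. (?u x > 0 \<longrightarrow> c x / lstar = 1) \<and> (?u x < 0 \<longrightarrow> c x / lstar = - 1) \<and>
          (?u x = 0 \<longrightarrow> c x / lstar \<in> {-1..1})"
        using AE_E c_E c_le
        by eventually_elim (use \<mu> assms(10) in \<open>auto simp: indicator_def field_simps\<close>)
      then show ?thesis by (simp add: sign_selections_def AE_completion_iff)
    qed
    moreover have "(\<lambda>x. - (lstar * (c x / lstar))) \<in> one_laplacian m \<nu> ?u"
    proof -
      \<comment> \<open>As the total variation is homogeneous, it suffices that \<open>c\<close> is a subgradient at \<open>0\<close> and that
      \<open>\<integral> c u\<close> is the total variation of \<open>u\<close>.\<close>
      have "enn2ereal (total_variation m \<nu> ?u) + ereal (\<integral>x. c x * (w x - ?u x) \<partial>completion \<nu>)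
          \<le> enn2ereal (total_variation m \<nu> w)" if w: "w \<in> L2 \<nu>" for w
      proof -
        have i: "integrable (completion \<nu>) (\<lambda>x. c x * v x)" if "v \<in> L2 \<nu>" for v
        proof (rule Bochner_Integration.integrable_bound[of _ "\<lambda>x. (c x)\<^sup>2 + (v x)\<^sup>2"])
          show "integrable (completion \<nu>) (\<lambda>x. (c x)\<^sup>2 + (v x)\<^sup>2)"
            using L2_bb[OF c] that by (simp add: L2_def)
          show "(\<lambda>x. c x * v x) \<in> borel_measurable (completion \<nu>)"
            using that by (auto simp: L2_def)
          have "\<bar>s * t\<bar> \<le> s\<^sup>2 + t\<^sup>2" for s t :: real
            using sum_squares_bound[of "\<bar>s\<bar>" "\<bar>t\<bar>", unfolded power2_abs mult.assoc]
              mult_nonneg_nonneg[OF abs_ge_zero[of s] abs_ge_zero[of t]]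
            unfolding abs_mult by linarith
          then show "AE x in completion \<nu>. norm (c x * v x) \<le> norm ((c x)\<^sup>2 + (v x)\<^sup>2)" by simp
        qed
        have "(\<integral>x. c x * (w x - ?u x) \<partial>completion \<nu>)
            = (\<integral>x. c x * w x \<partial>completion \<nu>) - (\<integral>x. c x * ?u x \<partial>completion \<nu>)"
          unfolding right_diff_distrib using i[OF w] i[OF u_L2] by (rule Bochner_Integration.integral_diff)
        also have "\<dots> = (\<integral>x. c x * w x \<partial>completion \<nu>) - lstar" by (simp only: cu)
        finally have "enn2ereal (total_variation m \<nu> ?u) + ereal (\<integral>x. c x * (w x - ?u x) \<partial>completion \<nu>)
            = ereal (\<integral>x. c x * w x \<partial>completion \<nu>)"
          unfolding tv_u using assms(10) by (simp add: enn2ereal_ennreal)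
        then show ?thesis using calibration_le_total_variation[OF c cal w] by (simp only:)
      qed
      then show ?thesis
        using assms(10) L2_bb[OF c] u_L2 tv_u
        by (simp add: one_laplacian_def subdifferential_def TV_functional_def enn2ereal_ennreal)
    qed
    moreover have "(\<integral>x. \<bar>?u x\<bar> \<partial>completion \<nu>) = 1"
    proof -
      have "\<bar>?u x\<bar> = ?u x" for x using \<mu> by simp
      then show ?thesis using int_u by (simp only:)
    qed
    ultimately show ?thesis
      using u_L2 unfolding eigenpair_def by (intro conjI bexI)
  qed
  ultimately show ?thesis
    using threshold ratio by (simp add: \<mu>_def)
qed

end
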